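(* Let $G=(V,E,c,[\lambda_{\min},\lambda_{\max}],s,t)$ be a source-sink-monotone parametric flow network with $n=|V|$ vertices and $m=|E|$ edges. If the initial maximum flow computation in PBFS is performed by an $\mathcal{O}(n^2m)$-time maximum-flow algorithm (incremental breadth-first search), then the algorithm PBFS described below runs in time $\mathcal{O}(n^2m)$ on $G$.
   Context: Flow networks, flows, cuts: a flow network $(V,E,c,s,t)$ has finite $V$, $E\subseteq V\times V$ with all reverse edges present (possibly capacity $0$), capacities $c\ge 0$. A flow $f$ satisfies $f(e)\le c(e)$, $f(u,v)=-f(v,u)$, and conservation at vertices other than $s,t$; residual capacity is $c(e)-f(e)$, an edge is residual if it is positive. A parametric flow network $G=(V,E,c,[\lambda_{\min},\lambda_{\max}],s,t)$ assigns each edge a capacity function $c(e)\colon[\lambda_{\min},\lambda_{\max}]\to\mathbb{R}_{\ge0}$ (e.g. affine functions); arithmetic on such functions and computing the smallest root of a function in an interval are treated as constant-time operations. $G[\lambda]$ is the flow network with capacities $c(e)(\lambda)$. It is source-sink-monotone if $c(s,v)$ is non-decreasing for $v\ne t$, $c(v,t)$ is non-increasing for $v\ne s$, and all other capacities are constant. Contracting $V'\subseteq V\setminus\{t\}$ into $s$ means removing $V'$, redirecting incident edges to/from $s$ and merging parallel edges. Algorithm PBFS. (1) Initialization: compute a maximum flow $f_{\rm init}$ in $G[\lambda_{\min}]$. By a reverse BFS from $t$ in its residual graph compute the set $V_t$ of vertices from which $t$ is reachable, a shortest-path in-tree $T$ rooted at $t$ of residual edges, and distance labels $d(v)$ (BFS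 distance to $t$; $d=\infty$ outside $V_t$). Set $\beta(v)=\lambda_{\min}$ for $v\notin V_t$, $\beta(v)=\infty$ for $v\in V_t$, and contract $V\setminus V_t$ into $s$. For each vertex $u$ keep a "current edge" pointer into its list of outgoing edges, initially at the first edge. (2) Flow functions: each edge carries a flow function $f(e)$ of $\lambda$ (with $f(v,u)=-f(u,v)$) and each vertex an excess function; initially $f=f_{\rm init}$ and all excesses $0$. For every edge $e=(s,v)$ or $e=(v,t)$ saturated by $f_{\rm init}$ at $\lambda_{\min}$, set $f(e):=c(e)$ as a function and add the resulting change to the excess function of $v$. Then drain at $\lambda_{\min}$. "Draining at $\lambda$" means: for the vertices $u\ne t$ with modified excess, in decreasing order of $d(u)$, add the excess function of $u$ to the flow function of $u$'s tree edge $e=(u,v)$ and to the excess of $v$, set the excess of $u$ to $0$, and set the flow limit $\lambda_{\rm root}(e)$ to the smallest root of $c(e)-f(e)$ in $[\lambda,\infty)$ ($\infty$ if none); non-tree edges have flow limit $\infty$. (3) Main loop, with $\lambda_0=\lambda_{\min}$, $i=0$, while $\lambda_i<\lambda_{\max}$: let $\lambda_{i+1}$ be the minimum flow limit over tree edges; if $\lambda_{i+1}>\lambda_{\max}$ return $\beta$. Residuality is evaluated at $\lambda_{i+1}$, ignoring edges into contracted vertices. Remove every tree edge $e=(u,v)$ with $\lambda_{\rm root}(e)=\lambda_{i+1}$ ("tree-edge removal": replace $f(e)$ by $c(e)+f(e)(\lambda_{i+1})-c(e)(\lambda_{i+1})$, add old minus new flow to the excess of $u$ and subtract it from the excess of $v$,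 set $\lambda_{\rm root}(e)=\infty$, delete $e$ from $T$, make $u$ an orphan). While orphans remain, take an orphan $u$: (a) advance $u$'s current-edge pointer looking for a residual edge $(u,v)$ with $d(u)=d(v)+1$; if found, add it to $T$ and continue. (b) Otherwise perform tree-edge removal on every tree edge into $u$ (making its tail an orphan); if $u$ has a residual outgoing edge, choose $(u,w)$ minimizing $d(w)$; if $d(w)<|V_t|-1$, set $d(u)=d(w)+1$, add $(u,w)$ to $T$ and reset $u$'s current-edge pointer. (c) Otherwise set $\beta(u)=\lambda_{i+1}$, remove $u$ from $V_t$ and contract $u$ into $s$. Then drain at $\lambda_{i+1}$, set $i:=i+1$ and repeat; return $\beta$ at the end. *)

theory Defs
  imports Complex_Main "HOL-Library.Extended_Real" "HOL-Library.Monad_Syntax"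
begin

section \<open>Flow networks\<close>

record ('v, 'c) network =
  verts :: "'v set"
  edges :: "('v \<times> 'v) set"
  cap :: "'v \<times> 'v \<Rightarrow> 'c"
  source :: 'v
  sink :: 'v

definition flow_network :: "('v, real) network \<Rightarrow> bool" where
  "flow_network N \<longleftrightarrow>
     finite (verts N) \<and> edges N \<subseteq> verts N \<times> verts N \<and> sym (edges N) \<and>
     source N \<in> verts N \<and> sink N \<in> verts N \<and> source N \<noteq> sink N \<and>
     (\<forall>e\<in>edges N. 0 \<le> cap N e)"

definition is_flow :: "('v, real) network \<Rightarrow> ('v \<times> 'v \<Rightarrow> real) \<Rightarrow> bool" where
  "is_flow N f \<longleftrightarrow>
     (\<forall>e\<in>edges N. f e \<le> cap N e) \<and>
     (\<forall>(u, v)\<in>edges N. f (u, v) = - f (v, u)) \<and>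
     (\<forall>v\<in>verts N - {source N, sink N}. (\<Sum>e\<in>{e \<in> edges N. fst e = v}. f e) = 0)"

definition flow_value :: "('v, real) network \<Rightarrow> ('v \<times> 'v \<Rightarrow> real) \<Rightarrow> real" where
  "flow_value N f = (\<Sum>e\<in>{e \<in> edges N. fst e = source N}. f e)"

definition is_maximum_flow :: "('v, real) network \<Rightarrow> ('v \<times> 'v \<Rightarrow> real) \<Rightarrow> bool" where
  "is_maximum_flow N f \<longleftrightarrow> is_flow N f \<and> (\<forall>g. is_flow N g \<longrightarrow> flow_value N g \<le> flow_value N f)"

text \<open>
  Capacity functions are total functions on the reals; only their values on the interval
  from \<open>lam_min\<close> to \<open>lam_max\<close> are constrained.
\<close>

record 'v parametric_network = "('v, real \<Rightarrow> real) network" +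
  lam_min :: real
  lam_max :: real

definition network_at :: "'v parametric_network \<Rightarrow> real \<Rightarrow> ('v, real) network" where
  "network_at G l =
     \<lparr>verts = verts G, edges = edges G, cap = (\<lambda>e. cap G e l), source = source G, sink = sink G\<rparr>"

definition parametric_flow_network :: "'v parametric_network \<Rightarrow> bool" where
  "parametric_flow_network G \<longleftrightarrow>
     lam_min G \<le> lam_max G \<and> (\<forall>l\<in>{lam_min G..lam_max G}. flow_network (network_at G l))"

definition source_sink_monotone :: "'v parametric_network \<Rightarrow> bool" where
  "source_sink_monotone G \<longleftrightarrow>
     (\<forall>(u, v)\<in>edges G.
        if u = source G \<and> v \<noteq> sink G then
          \<forall>l\<in>{lam_min G..lam_max G}. \<forall>l'\<in>{lam_min G..lam_max G}.
            l \<le> l' \<longrightarrow> cap G (u, v) l \<le> cap G (u, v) l'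
        else if v = sink G \<and> u \<noteq> source G then
          \<forall>l\<in>{lam_min G..lam_max G}. \<forall>l'\<in>{lam_min G..lam_max G}.
            l \<le> l' \<longrightarrow> cap G (u, v) l' \<le> cap G (u, v) l
        else
          \<forall>l\<in>{lam_min G..lam_max G}. \<forall>l'\<in>{lam_min G..lam_max G}.
            cap G (u, v) l = cap G (u, v) l')"

text \<open>
  The value is \<open>\<infinity>\<close> if there is no root in \<open>[l, \<infinity>)\<close>, and also if the set of
  roots has no least element, which cannot happen for continuous functions.
\<close>

definition smallest_root :: "(real \<Rightarrow> real) \<Rightarrow> real \<Rightarrow> ereal" where
  "smallest_root g l =
     (if \<exists>x\<ge>l. g x = 0 \<and> (\<forall>y\<ge>l. g y = 0 \<longrightarrow> x \<le> y)
      then ereal (THE x. x \<ge> l \<and> g x = 0 \<and> (\<forall>y\<ge>l. g y = 0 \<longrightarrow> x \<le> y))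
      else \<infinity>)"


section \<open>Nondeterministic computations with a cost\<close>

text \<open>
  A computation is the set of its possible outcomes, each a result with the time spent.
  Cost model: every loop iteration (\<open>foreach\<close>, \<open>find_from\<close>) costs one unit, which
  pays for the constantly many elementary operations in its body: array access, arithmetic on
  numbers and on functions of the parameter, evaluation, and \<open>smallest_root\<close>. Maps on
  vertices and edges are arrays; the cardinality of a maintained set is a counter.
\<close>

datatype 'a comp = Comp (outcomes: "('a \<times> nat) set")

definition ret :: "'a \<Rightarrow> 'a comp" where
  "ret x = Comp {(x, 0)}"

definition tick :: "unit comp" where
  "tick = Comp {((), 1)}"

definition choose_from :: "'a set \<Rightarrow> 'a comp" where
  "choose_from A = Comp ((\<lambda>x. (x, 0)) ` A)"

definition bind_comp :: "'a comp \<Rightarrow> ('a \<Rightarrow> 'b comp) \<Rightarrow> 'b comp" where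
  "bind_comp m f =
     Comp {(y, i + j) | x i y j. (x, i) \<in> outcomes m \<and> (y, j) \<in> outcomes (f x)}"

adhoc_overloading bind \<rightleftharpoons> bind_comp

fun foreach :: "'b list \<Rightarrow> ('b \<Rightarrow> 'a \<Rightarrow> 'a comp) \<Rightarrow> 'a \<Rightarrow> 'a comp" where
  "foreach [] f a = ret a"
| "foreach (x # xs) f a = do { tick; a' \<leftarrow> f x a; foreach xs f a' }"

definition traverse :: "'b list \<Rightarrow> unit comp" where
  "traverse xs = foreach xs (\<lambda>_ _. ret ()) ()"

text \<open>
  Position of the first element satisfying \<open>P\<close> in a list whose head has position
  \<open>i\<close>, or the position after the end.
\<close>

fun find_from :: "('b \<Rightarrow> bool) \<Rightarrow> 'b list \<Rightarrow> nat \<Rightarrow> nat comp" where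
  "find_from P [] i = ret i"
| "find_from P (x # xs) i = do { tick; if P x then ret i else find_from P xs (Suc i) }"

definition maximum_flow_algorithm ::
    "(('v, real) network \<Rightarrow> ('v \<times> 'v \<Rightarrow> real) comp) \<Rightarrow> bool" where
  "maximum_flow_algorithm A \<longleftrightarrow>
     (\<forall>N. flow_network N \<longrightarrow>
        outcomes (A N) \<noteq> {} \<and> (\<forall>(f, k)\<in>outcomes (A N). is_maximum_flow N f))"


section \<open>The algorithm PBFS\<close>

text \<open>
  The in-tree \<open>T\<close> consists of the edges \<open>(u, v)\<close> with \<open>parent u = Some v\<close>.
  The field \<open>net\<close> is the current, successively contracted network; its vertices are
  \<open>Vt\<close> and the source. The set \<open>modified\<close> holds the vertices whose excess
  function has been modified since it was last drained.
\<close>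

record 'v pbfs =
  net :: "'v parametric_network"
  Vt :: "'v set"
  parent :: "'v \<Rightarrow> 'v option"
  label :: "'v \<Rightarrow> enat"
  beta :: "'v \<Rightarrow> ereal"
  ptr :: "'v \<Rightarrow> nat"
  flow :: "'v \<times> 'v \<Rightarrow> real \<Rightarrow> real"
  excess :: "'v \<Rightarrow> real \<Rightarrow> real"
  modified :: "'v set"
  limit :: "'v \<times> 'v \<Rightarrow> ereal"
  orphans :: "'v set"

text \<open>
  Vertex and adjacency lists in arbitrary order. Loops carry no flow by antisymmetry and are
  omitted. The lists are never changed: entries whose head has left \<open>Vt\<close> are ignored
  instead.
\<close>

definition represents ::
    "'v list \<Rightarrow> ('v \<Rightarrow> ('v \<times> 'v) list) \<Rightarrow> 'v parametric_network \<Rightarrow> bool" where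
  "represents vs adj G \<longleftrightarrow>
     distinct vs \<and> set vs = verts G \<and>
     (\<forall>u\<in>verts G. distinct (adj u) \<and> set (adj u) = {(u, v) | v. (u, v) \<in> edges G \<and> u \<noteq> v})"

definition residual :: "real \<Rightarrow> 'v pbfs \<Rightarrow> 'v \<times> 'v \<Rightarrow> bool" where
  "residual l S e \<longleftrightarrow> cap (net S) e l - flow S e l > 0"

definition set_flow :: "'v \<Rightarrow> 'v \<Rightarrow> (real \<Rightarrow> real) \<Rightarrow> 'v pbfs \<Rightarrow> 'v pbfs" where
  "set_flow u v g S = S\<lparr>flow := (flow S)((u, v) := g, (v, u) := (\<lambda>x. - g x))\<rparr>"

definition add_excess :: "'v \<Rightarrow> (real \<Rightarrow> real) \<Rightarrow> 'v pbfs \<Rightarrow> 'v pbfs" where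
  "add_excess u g S =
     S\<lparr>excess := (excess S)(u := (\<lambda>x. excess S u x + g x)), modified := insert u (modified S)\<rparr>"

text \<open>Contraction of \<open>U\<close> into \<open>s\<close>; parallel edges are merged, loops at \<open>s\<close> dropped.\<close>

definition redirect :: "'v \<Rightarrow> 'v set \<Rightarrow> 'v \<times> 'v \<Rightarrow> 'v \<times> 'v" where
  "redirect s U = (\<lambda>(a, b). (if a \<in> U then s else a, if b \<in> U then s else b))"

definition merge ::
    "'v \<Rightarrow> 'v set \<Rightarrow> ('v \<times> 'v) set \<Rightarrow> ('v \<times> 'v \<Rightarrow> real \<Rightarrow> real) \<Rightarrow> ('v \<times> 'v \<Rightarrow> real \<Rightarrow> real)" where
  "merge s U E g = (\<lambda>e x. \<Sum>e'\<in>{e' \<in> E. redirect s U e' = e}. g e' x)"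

definition contract :: "'v set \<Rightarrow> 'v pbfs \<Rightarrow> 'v pbfs" where
  "contract U S =
     (let N = net S; s = source N in
      S\<lparr>net := N\<lparr>verts := insert s (verts N - U),
                 edges := redirect s U ` edges N - {(s, s)},
                 cap := merge s U (edges N) (cap N)\<rparr>,
        flow := merge s U (edges N) (flow S)\<rparr>)"

definition remove_tree_edge :: "real \<Rightarrow> 'v \<Rightarrow> 'v \<Rightarrow> 'v pbfs \<Rightarrow> 'v pbfs" where
  "remove_tree_edge l u v S =
     (let c = cap (net S) (u, v);
          old = flow S (u, v);
          new = (\<lambda>x. c x + old l - c l);
          S' = add_excess v (\<lambda>x. - (old x - new x))
                 (add_excess u (\<lambda>x. old x - new x) (set_flow u v new S))
      in S'\<lparr>limit := (limit S')((u, v) := \<infinity>),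
            parent := (parent S')(u := None),
            orphans := insert u (orphans S')\<rparr>)"

definition saturate_source_edge :: "'v \<Rightarrow> 'v pbfs \<Rightarrow> 'v pbfs" where
  "saturate_source_edge v S =
     (let N = net S; e = (source N, v); l = lam_min N; old = flow S e in
      if e \<in> edges N \<and> flow S e l = cap N e l
      then add_excess v (\<lambda>x. cap N e x - old x) (set_flow (source N) v (cap N e) S)
      else S)"

definition saturate_sink_edge :: "'v \<Rightarrow> 'v pbfs \<Rightarrow> 'v pbfs" where
  "saturate_sink_edge v S =
     (let N = net S; e = (v, sink N); l = lam_min N; old = flow S e in
      if v \<noteq> sink N \<and> e \<in> edges N \<and> flow S e l = cap N e l
      then add_excess v (\<lambda>x. old x - cap N e x) (set_flow v (sink N) (cap N e) S)
      else S)"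

definition set_limit :: "real \<Rightarrow> 'v \<Rightarrow> 'v \<Rightarrow> 'v pbfs \<Rightarrow> 'v pbfs" where
  "set_limit l u v S =
     S\<lparr>limit := (limit S)
        ((u, v) := smallest_root (\<lambda>x. cap (net S) (u, v) x - flow S (u, v) x) l)\<rparr>"

definition drain_vertex :: "real \<Rightarrow> 'v \<Rightarrow> 'v pbfs \<Rightarrow> 'v pbfs comp" where
  "drain_vertex l u S =
     (if u \<in> modified S then do {
        v \<leftarrow> choose_from {v. parent S u = Some v};
        let x = excess S u;
        let S = set_flow u v (\<lambda>y. flow S (u, v) y + x y) S;
        let S = add_excess v x S;
        let S = S\<lparr>excess := (excess S)(u := (\<lambda>_. 0)), modified := modified S - {u}\<rparr>;
        ret (set_limit l u v S)
      } else ret S)"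

datatype 'v config =
    Start
  | Reverse_BFS "'v list" "'v pbfs" \<comment> \<open>queue\<close>
  | Main_Loop real "'v pbfs" \<comment> \<open>\<open>\<lambda>\<^sub>i\<close>\<close>
  | Adoption real "'v pbfs" \<comment> \<open>\<open>\<lambda>\<^sub>i\<^sub>+\<^sub>1\<close>\<close>
  | Return "'v \<Rightarrow> ereal"

context
  fixes A :: "('v, real) network \<Rightarrow> ('v \<times> 'v \<Rightarrow> real) comp"
    and G :: "'v parametric_network"
    and vs :: "'v list"
    and adj :: "'v \<Rightarrow> ('v \<times> 'v) list"
begin

definition initialize :: "'v pbfs comp" where
  "initialize = do {
     f_init \<leftarrow> A (network_at G (lam_min G));
     traverse vs;
     foreach vs (\<lambda>v _. traverse (adj v)) ();
     ret \<lparr>net = G, Vt = {sink G}, parent = (\<lambda>_. None), label = (\<lambda>_. \<infinity>)(sink G := 0),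
          beta = (\<lambda>_. \<infinity>), ptr = (\<lambda>_. 0), flow = (\<lambda>e _. f_init e), excess = (\<lambda>_ _. 0),
          modified = {}, limit = (\<lambda>_. \<infinity>), orphans = {}\<rparr>
   }"

definition visit :: "'v \<Rightarrow> 'v list \<Rightarrow> 'v pbfs \<Rightarrow> ('v list \<times> 'v pbfs) comp" where
  "visit v queue S =
     foreach (adj v) (\<lambda>(_, u) (q, S).
       ret (if u \<notin> Vt S \<and> residual (lam_min G) S (u, v)
            then (q @ [u],
                  S\<lparr>Vt := insert u (Vt S),
                    parent := (parent S)(u := Some v),
                    label := (label S)(u := label S v + 1)\<rparr>)
            else (q, S)))
     (queue, S)"

text \<open>Vertices are sorted by distance label with a bucket sort.\<close>

definition drain :: "real \<Rightarrow> 'v pbfs \<Rightarrow> 'v pbfs comp" where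
  "drain l S = do {
     bucket \<leftarrow> foreach vs (\<lambda>v b.
       ret (if v \<in> Vt S \<and> v \<noteq> sink G then b(label S v := v # b (label S v)) else b)) (\<lambda>_. []);
     foreach (rev [1..<length vs]) (\<lambda>k. foreach (bucket (enat k)) (drain_vertex l)) S
   }"

text \<open>
  The contraction of \<open>U\<close> is paid for by a traversal of the adjacency lists of the vertices
  in \<open>U\<close>, whose edges are redirected.
  Every tree edge gets a flow limit before the first drain, since a tree edge into the sink may
  saturate through its decreasing capacity even if its tail has no excess to drain.
\<close>

definition set_up :: "'v pbfs \<Rightarrow> 'v pbfs comp" where
  "set_up S = do {
     S \<leftarrow> foreach vs (\<lambda>v S.
       ret (S\<lparr>beta := (beta S)(v := if v \<in> Vt S then \<infinity> else ereal (lam_min G))\<rparr>)) S;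
     foreach vs (\<lambda>v _. if v \<in> Vt S then ret () else traverse (adj v)) ();
     let S = contract (verts G - Vt S) S;
     S \<leftarrow> foreach vs (\<lambda>v S.
       ret (if v \<in> Vt S then saturate_sink_edge v (saturate_source_edge v S) else S)) S;
     S \<leftarrow> foreach vs (\<lambda>u S.
       ret (case parent S u of None \<Rightarrow> S | Some v \<Rightarrow> set_limit (lam_min G) u v S)) S;
     drain (lam_min G) S
   }"

definition minimum_limit :: "'v pbfs \<Rightarrow> ereal comp" where
  "minimum_limit S =
     foreach vs (\<lambda>u b.
       ret (case parent S u of None \<Rightarrow> b | Some v \<Rightarrow> min b (limit S (u, v)))) \<infinity>"

definition remove_saturated :: "real \<Rightarrow> 'v pbfs \<Rightarrow> 'v pbfs comp" where
  "remove_saturated l S =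
     foreach vs (\<lambda>u S.
       ret (case parent S u of
              None \<Rightarrow> S
            | Some v \<Rightarrow> if limit S (u, v) = ereal l then remove_tree_edge l u v S else S)) S"

definition admissible :: "real \<Rightarrow> 'v pbfs \<Rightarrow> 'v \<times> 'v \<Rightarrow> bool" where
  "admissible l S = (\<lambda>(u, v). v \<in> Vt S \<and> residual l S (u, v) \<and> label S u = label S v + 1)"

definition remove_children :: "real \<Rightarrow> 'v \<Rightarrow> 'v pbfs \<Rightarrow> 'v pbfs comp" where
  "remove_children l u S =
     foreach (adj u) (\<lambda>(_, v) S.
       ret (if parent S v = Some u then remove_tree_edge l v u S else S)) S"

definition closest_residual :: "real \<Rightarrow> 'v \<Rightarrow> 'v pbfs \<Rightarrow> 'v option comp" where
  "closest_residual l u S =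
     foreach (adj u) (\<lambda>(_, w) best.
       if w \<in> Vt S \<and> residual l S (u, w) then
         (case best of
            None \<Rightarrow> ret (Some w)
          | Some w' \<Rightarrow>
              if label S w < label S w' then ret (Some w)
              else if label S w' < label S w then ret (Some w')
              else choose_from {Some w, Some w'})
       else ret best) None"

definition process_orphan :: "real \<Rightarrow> 'v \<Rightarrow> 'v pbfs \<Rightarrow> 'v pbfs comp" where
  "process_orphan l u S = do {
     i \<leftarrow> find_from (admissible l S) (drop (ptr S u) (adj u)) (ptr S u);
     let S = S\<lparr>ptr := (ptr S)(u := i)\<rparr>;
     if i < length (adj u) then
       ret (S\<lparr>parent := (parent S)(u := Some (snd (adj u ! i)))\<rparr>)
     else do {
       S \<leftarrow> remove_children l u S;
       best \<leftarrow> closest_residual l u S;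
       let relabel =
         (case best of None \<Rightarrow> False | Some w \<Rightarrow> label S w < enat (card (Vt S) - 1));
       if relabel then
         ret (S\<lparr>label := (label S)(u := label S (the best) + 1),
                parent := (parent S)(u := best),
                ptr := (ptr S)(u := 0)\<rparr>)
       else do {
         traverse (adj u);
         ret (contract {u} (S\<lparr>beta := (beta S)(u := ereal l), Vt := Vt S - {u}\<rparr>))
       }
     }
   }"

fun step :: "'v config \<Rightarrow> 'v config comp" where
  "step Start = do {
     S \<leftarrow> initialize;
     ret (Reverse_BFS [sink G] S)
   }"
| "step (Reverse_BFS (v # q) S) = do {
     (q, S) \<leftarrow> visit v q S;
     ret (Reverse_BFS q S)
   }"
| "step (Reverse_BFS [] S) = do {
     S \<leftarrow> set_up S;
     ret (Main_Loop (lam_min G) S)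
   }"
| "step (Main_Loop l S) =
     (if l < lam_max G then do {
        l' \<leftarrow> minimum_limit S;
        if l' > ereal (lam_max G) then ret (Return (beta S))
        else do {
          S \<leftarrow> remove_saturated (real_of_ereal l') S;
          ret (Adoption (real_of_ereal l') S)
        }
      } else ret (Return (beta S)))"
| "step (Adoption l S) =
     (if orphans S \<noteq> {} then do {
        u \<leftarrow> choose_from (orphans S);
        S \<leftarrow> process_orphan l u (S\<lparr>orphans := orphans S - {u}\<rparr>);
        ret (Adoption l S)
      } else do {
        S \<leftarrow> drain l S;
        ret (Main_Loop l S)
      })"
| "step (Return b) = Comp {}"

text \<open>\<open>run c k\<close>: some partial execution reaches \<open>c\<close> after time \<open>k\<close>.\<close>

inductive run :: "'v config \<Rightarrow> nat \<Rightarrow> bool" where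
  start: "run Start 0"
| step: "run c k \<Longrightarrow> (c', j) \<in> outcomes (step c) \<Longrightarrow> run c' (k + j + 1)"

text \<open>
  Every partial execution takes time at most \<open>B\<close> and gets stuck only by returning. As each
  step takes positive time, this includes termination of all executions.
\<close>

definition pbfs_runs_in_time :: "nat \<Rightarrow> bool" where
  "pbfs_runs_in_time B \<longleftrightarrow>
     (\<forall>c k. run c k \<longrightarrow> k \<le> B \<and> ((\<exists>b. c = Return b) \<or> outcomes (step c) \<noteq> {}))"

end

end

theory Submission
  imports Defs
begin

text \<open>
  The amortized analysis of push-relabel algorithms applies, with the change of \<open>\<lambda>\<close> in the role
  of the pushes. A residual edge \<open>(u, v)\<close> inside \<open>Vt\<close> always satisfies
  \<open>d(u) \<le> d(v) + 1\<close>, because an increase of \<open>\<lambda>\<close> changes residual capacities only along tree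
  edges and their reverses: capacities are constant away from \<open>s\<close> and \<open>t\<close>, a removed tree edge
  keeps a constant residual capacity, and non-tree edges into \<open>t\<close> are saturated for all
  \<open>\<lambda>\<close>. Here \<open>s\<close> is outside \<open>Vt\<close> because the initial flow is maximum. Hence edges before the
  current edge stay inadmissible and a relabel strictly increases \<open>d(u) < n\<close>. Every orphan
  therefore advances its current edge, gets a larger label, or is contracted, which bounds the
  adoption work by \<open>O(n m)\<close>; every iteration of the main loop creates an orphan, so
  there are \<open>O(n m)\<close> iterations with an overhead of \<open>O(n)\<close> each. Excess functions only affect
  flows on tree edges and play no role for the running time.
\<close>

section \<open>Costs of nondeterministic computations\<close>

text \<open>The obstacle is to measure progress. The current-edge pointer alone does not do it: a
  relabel resets it to 0 but attaches the vertex to a closest head anywhere in its list, so a later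
  scan may stop at position 0 without having moved the pointer. Hence a ghost pointer
  \<open>D\<close> that occurs only in the invariant, and a potential that adds the ghost pointers
  to degree-weighted labels and stays at most \<open>16 * n * card E\<close>. Processing an orphan
  in time \<open>k\<close> raises three times the potential by at least \<open>k + 1\<close>. The
  first orphan of an iteration also carries the overhead of that iteration, at most
  \<open>3 * n\<close> before and \<open>4 * n\<close> after it; as it raises the potential by at
  least 1, \<open>9 * n\<close> per unit of potential suffices. This yields
  \<open>144 = 9 * 16\<close>. While an orphan is processed, its children are detached along edges
  that may still be residual, so their scanned edges need not all be dead. The parameter
  \<open>X\<close> of the invariant excuses edges into that orphan until it is relabeled or
  contracted.\<close>

text \<open>Total correctness under demonic nondeterminism. Nonemptiness is part of it because
  \<open>pbfs_runs_in_time\<close> also demands that no execution gets stuck.\<close>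

definition post :: "'a comp \<Rightarrow> ('a \<Rightarrow> nat \<Rightarrow> bool) \<Rightarrow> bool" where
  "post m P \<longleftrightarrow> outcomes m \<noteq> {} \<and> (\<forall>(x, k)\<in>outcomes m. P x k)"

lemma post_ret [simp]: "post (ret x) P \<longleftrightarrow> P x 0"
  by (simp add: post_def ret_def)

lemma post_tick [simp]: "post tick P \<longleftrightarrow> P () 1"
  by (simp add: post_def tick_def)

lemma post_choose_from [simp]: "post (choose_from A) P \<longleftrightarrow> A \<noteq> {} \<and> (\<forall>x\<in>A. P x 0)"
  by (auto simp: post_def choose_from_def)

lemma post_mono: "post m P \<Longrightarrow> (\<And>x k. P x k \<Longrightarrow> Q x k) \<Longrightarrow> post m Q"
  by (auto simp: post_def)

lemma post_bind:
  assumes "post m (\<lambda>x i. post (f x) (\<lambda>y j. P y (i + j)))"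
  shows "post (bind_comp m f) P"
proof -
  obtain x i where x: "(x, i) \<in> outcomes m"
    using assms by (auto simp: post_def)
  with assms have "post (f x) (\<lambda>y j. P y (i + j))"
    by (auto simp: post_def)
  then obtain y j where "(y, j) \<in> outcomes (f x)"
    by (auto simp: post_def)
  with x have "(y, i + j) \<in> outcomes (bind_comp m f)"
    by (auto simp: bind_comp_def)
  then have "outcomes (bind_comp m f) \<noteq> {}"
    by blast
  moreover have "P z k" if "(z, k) \<in> outcomes (bind_comp m f)" for z k
    using that assms by (fastforce simp: post_def bind_comp_def)
  ultimately show ?thesis
    by (auto simp: post_def)
qed

lemma post_foreach:
  assumes "I [] a"
    and "\<And>ys x zs a. xs = ys @ x # zs \<Longrightarrow> I ys a \<Longrightarrow>
           post (f x a) (\<lambda>a' k. I (ys @ [x]) a' \<and> k \<le> c x)"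
  shows "post (foreach xs f a) (\<lambda>a' k. I xs a' \<and> k \<le> (\<Sum>x\<leftarrow>xs. c x + 1))"
proof -
  have "post (foreach zs f a) (\<lambda>a' k. I xs a' \<and> k \<le> (\<Sum>x\<leftarrow>zs. c x + 1))"
    if "xs = ys @ zs" "I ys a" for ys zs a
    using that
  proof (induction zs arbitrary: ys a)
    case (Cons z zs)
    have "post (f z a) (\<lambda>a' i. post (foreach zs f a')
        (\<lambda>b j. I xs b \<and> 1 + (i + j) \<le> c z + 1 + (\<Sum>x\<leftarrow>zs. c x + 1)))"
    proof (rule post_mono[OF assms(2)[OF Cons.prems]])
      fix a' i assume "I (ys @ [z]) a' \<and> i \<le> c z"
      with Cons.prems(1) show "post (foreach zs f a')
          (\<lambda>b j. I xs b \<and> 1 + (i + j) \<le> c z + 1 + (\<Sum>x\<leftarrow>zs. c x + 1))"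
        by (intro post_mono[OF Cons.IH[of "ys @ [z]" a']]) auto
    qed
    then show ?case
      by (auto intro!: post_bind)
  qed simp
  from this[of "[]" xs a] assms(1) show ?thesis
    by simp
qed

lemma post_foreach_ret:
  assumes "I [] a"
    and "\<And>ys x zs a. xs = ys @ x # zs \<Longrightarrow> I ys a \<Longrightarrow> I (ys @ [x]) (g x a)"
  shows "post (foreach xs (\<lambda>x a. ret (g x a)) a) (\<lambda>a' k. I xs a' \<and> k \<le> length xs)"
  using post_foreach[of I a xs "\<lambda>x a. ret (g x a)" "\<lambda>_. 0"] assms by (simp add: sum_list_triv)

lemma post_traverse: "post (traverse xs) (\<lambda>_ k. k \<le> length xs)"
  unfolding traverse_def
  using post_foreach_ret[of "\<lambda>_ _. True" "()" xs "\<lambda>_ _. ()"] by simp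

text \<open>The cost is expressed by the distance travelled, so that a scan can be charged to the
  movement of the pointer; the additional 1 is the test of the element found.\<close>

lemma post_find_from:
  "post (find_from P xs i) (\<lambda>j k. i \<le> j \<and> j \<le> i + length xs \<and> k \<le> j - i + 1 \<and>
     (\<forall>m. i \<le> m \<longrightarrow> m < j \<longrightarrow> \<not> P (xs ! (m - i))) \<and> (j < i + length xs \<longrightarrow> P (xs ! (j - i))))"
proof (induction xs arbitrary: i)
  case (Cons x xs)
  have "post (if P x then ret i else find_from P xs (Suc i))
     (\<lambda>j k. i \<le> j \<and> j \<le> i + length (x # xs) \<and> 1 + k \<le> j - i + 1 \<and>
     (\<forall>m. i \<le> m \<longrightarrow> m < j \<longrightarrow> \<not> P ((x # xs) ! (m - i))) \<and>
     (j < i + length (x # xs) \<longrightarrow> P ((x # xs) ! (j - i))))"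
  proof (cases "P x")
    case False
    show ?thesis
      unfolding if_not_P[OF False]
    proof (rule post_mono[OF Cons.IH], intro conjI allI impI; elim conjE)
      fix j k m
      assume "\<forall>m. Suc i \<le> m \<longrightarrow> m < j \<longrightarrow> \<not> P (xs ! (m - Suc i))" "i \<le> m" "m < j"
      then show "\<not> P ((x # xs) ! (m - i))"
        using False by (cases "m = i") (auto simp: nth_Cons' Suc_diff_le)
    qed (auto simp: nth_Cons')
  qed auto
  then show ?case
    by (auto intro!: post_bind)
qed auto

section \<open>Maximum flows and residual walks\<close>

definition residual_edges :: "('v, real) network \<Rightarrow> ('v \<times> 'v \<Rightarrow> real) \<Rightarrow> ('v \<times> 'v) set" where
  "residual_edges N f = {e \<in> edges N. f e < cap N e \<and> fst e \<noteq> snd e}"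

text \<open>
  Superposing one unit along each edge of a residual walk gives a flow that is positive only on
  residual edges, so the walk need not be simple.
\<close>

lemma unit_flow_along_residual_walk:
  assumes N: "flow_network N" and walk: "(x, t) \<in> (residual_edges N f)\<^sup>*"
  shows "\<exists>h. (\<forall>e\<in>edges N. 0 < h e \<longrightarrow> f e < cap N e) \<and>
             (\<forall>(u, v)\<in>edges N. h (u, v) = - h (v, u)) \<and>
             (\<forall>v. (\<Sum>e\<in>{e \<in> edges N. fst e = v}. h e) = of_bool (v = x) - (of_bool (v = t) :: real))"
  using walk
proof (induction rule: converse_rtrancl_induct)
  case base
  show ?case
    by (rule exI[of _ "\<lambda>_. 0"]) auto
next
  case (step x y)
  then obtain h where
    h: "\<And>e. e \<in> edges N \<Longrightarrow> 0 < h e \<Longrightarrow> f e < cap N e"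
       "\<And>u v. (u, v) \<in> edges N \<Longrightarrow> h (u, v) = - h (v, u)"
       "\<And>v. (\<Sum>e\<in>{e \<in> edges N. fst e = v}. h e) = of_bool (v = y) - (of_bool (v = t) :: real)"
    by fast
  have fin: "finite (edges N)"
    using N unfolding flow_network_def by (blast intro: finite_subset[OF _ finite_cartesian_product])
  have xy: "(x, y) \<in> edges N" "f (x, y) < cap N (x, y)" "x \<noteq> y"
    using step.hyps(1) by (auto simp: residual_edges_def)
  then have yx: "(y, x) \<in> edges N"
    using N by (auto simp: flow_network_def sym_def)
  let ?h = "\<lambda>e. h e + (of_bool (e = (x, y)) - of_bool (e = (y, x)))"
  have "f e < cap N e" if "e \<in> edges N" "0 < ?h e" for e
    using that h(1)[of e] xy by (cases "e = (x, y)"; cases "e = (y, x)") auto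
  moreover have "?h (u, v) = - ?h (v, u)" if "(u, v) \<in> edges N" for u v
  proof -
    have "(v, u) = (x, y) \<longleftrightarrow> (u, v) = (y, x)" "(v, u) = (y, x) \<longleftrightarrow> (u, v) = (x, y)"
      by blast+
    with h(2)[OF that] show ?thesis
      by simp
  qed
  moreover have "(\<Sum>e\<in>{e \<in> edges N. fst e = v}. ?h e) = of_bool (v = x) - (of_bool (v = t) :: real)" for v
  proof -
    have count: "(\<Sum>e\<in>{e \<in> edges N. fst e = v}. of_bool (e = d)) = (of_bool (v = fst d) :: real)"
      if "d \<in> edges N" for d
      using that fin by (auto simp: of_bool_def sum.delta)
    show ?thesis
      unfolding sum.distrib sum_subtractf count[OF xy(1)] count[OF yx] h(3) by auto
  qed
  ultimately show ?case
    by (intro exI[of _ ?h]) fast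
qed

text \<open>The unit flow \<open>h\<close> along such a walk has value 1 and is positive only where
  capacity is left, so adding a small multiple of it gives a flow of larger value.\<close>

lemma maximum_flow_no_residual_walk:
  assumes N: "flow_network N" and f: "is_maximum_flow N f"
  shows "(source N, sink N) \<notin> (residual_edges N f)\<^sup>*"
proof
  assume "(source N, sink N) \<in> (residual_edges N f)\<^sup>*"
  then obtain h where
    h: "\<And>e. e \<in> edges N \<Longrightarrow> 0 < h e \<Longrightarrow> f e < cap N e"
       "\<And>u v. (u, v) \<in> edges N \<Longrightarrow> h (u, v) = - h (v, u)"
       "\<And>v. (\<Sum>e\<in>{e \<in> edges N. fst e = v}. h e) =
              of_bool (v = source N) - (of_bool (v = sink N) :: real)"
    using unit_flow_along_residual_walk[OF N] by fast
  have fin: "finite (edges N)"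
    using N unfolding flow_network_def by (blast intro: finite_subset[OF _ finite_cartesian_product])
  have ne: "source N \<noteq> sink N"
    using N by (simp add: flow_network_def)
  have fl: "is_flow N f"
    using f by (simp add: is_maximum_flow_def)
  \<comment> \<open>The bottleneck of the augmentation. A walk may repeat an edge, so
    \<open>h\<close> can exceed 1 and the residual capacity is divided by it. The element 1 keeps
    the set nonempty.\<close>
  define \<epsilon> where "\<epsilon> = Min (insert 1 ((\<lambda>e. (cap N e - f e) / h e) ` {e \<in> edges N. 0 < h e}))"
  have "\<epsilon> > 0"
    unfolding \<epsilon>_def using fin h(1) by (subst Min_gr_iff) auto
  have le: "f e + \<epsilon> * h e \<le> cap N e" if "e \<in> edges N" for e
  proof (cases "0 < h e")
    case True
    then have "\<epsilon> \<le> (cap N e - f e) / h e"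
      unfolding \<epsilon>_def using fin that by (intro Min_le) auto
    with True show ?thesis
      by (simp add: field_simps)
  next
    case False
    then have "\<epsilon> * h e \<le> 0"
      using \<open>\<epsilon> > 0\<close> by (simp add: mult_le_0_iff)
    moreover have "f e \<le> cap N e"
      using fl that by (simp add: is_flow_def)
    ultimately show ?thesis
      by simp
  qed
  have total: "(\<Sum>e\<in>{e \<in> edges N. fst e = v}. f e + \<epsilon> * h e) =
      (\<Sum>e\<in>{e \<in> edges N. fst e = v}. f e) + \<epsilon> * (of_bool (v = source N) - of_bool (v = sink N))" for v
    using h(3)[of v] by (simp add: sum.distrib sum_distrib_left[symmetric])
  have "is_flow N (\<lambda>e. f e + \<epsilon> * h e)"
    unfolding is_flow_def total
  proof (intro conjI ballI)
    fix v assume "v \<in> verts N - {source N, sink N}"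
    then show "(\<Sum>e\<in>{e \<in> edges N. fst e = v}. f e) + \<epsilon> * (of_bool (v = source N) - of_bool (v = sink N)) = 0"
      using fl by (simp add: is_flow_def)
  next
    fix d assume "d \<in> edges N"
    then show "case d of (u, v) \<Rightarrow> f (u, v) + \<epsilon> * h (u, v) = - (f (v, u) + \<epsilon> * h (v, u))"
      using fl h(2)[of "fst d" "snd d"] by (auto simp: is_flow_def)
  qed (rule le)
  moreover have "flow_value N (\<lambda>e. f e + \<epsilon> * h e) = flow_value N f + \<epsilon>"
    unfolding flow_value_def total using ne by simp
  ultimately show False
    using f \<open>\<epsilon> > 0\<close> by (force simp: is_maximum_flow_def)
qed

section \<open>Invariants of the main loop\<close>

lemma smallest_root_cases:
  "smallest_root g l = \<infinity> \<or> (\<exists>x\<ge>l. smallest_root g l = ereal x \<and> g x = 0)"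
proof (cases "\<exists>x\<ge>l. g x = 0 \<and> (\<forall>y\<ge>l. g y = 0 \<longrightarrow> x \<le> y)")
  case True
  then obtain x where x: "x \<ge> l" "g x = 0" "\<forall>y\<ge>l. g y = 0 \<longrightarrow> x \<le> y"
    by blast
  then have "(THE x. x \<ge> l \<and> g x = 0 \<and> (\<forall>y\<ge>l. g y = 0 \<longrightarrow> x \<le> y)) = x"
    by (intro the_equality) (auto intro: antisym)
  with True x show ?thesis
    unfolding smallest_root_def by auto
next
  case False
  then show ?thesis
    unfolding smallest_root_def by auto
qed

lemma remove_tree_edge_simps [simp]:
  "net (remove_tree_edge l u v S) = net S"
  "Vt (remove_tree_edge l u v S) = Vt S"
  "parent (remove_tree_edge l u v S) = (parent S)(u := None)"
  "label (remove_tree_edge l u v S) = label S"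
  "beta (remove_tree_edge l u v S) = beta S"
  "ptr (remove_tree_edge l u v S) = ptr S"
  "limit (remove_tree_edge l u v S) = (limit S)((u, v) := \<infinity>)"
  "orphans (remove_tree_edge l u v S) = insert u (orphans S)"
  by (simp_all add: remove_tree_edge_def Let_def add_excess_def set_flow_def)

lemma flow_remove_tree_edge:
  "flow (remove_tree_edge l u v S) =
     (flow S)((u, v) := (\<lambda>x. cap (net S) (u, v) x + flow S (u, v) l - cap (net S) (u, v) l),
              (v, u) := (\<lambda>x. - (cap (net S) (u, v) x + flow S (u, v) l - cap (net S) (u, v) l)))"
  by (simp add: remove_tree_edge_def Let_def add_excess_def set_flow_def)

lemma set_limit_simps [simp]:
  "net (set_limit l u v S) = net S" "Vt (set_limit l u v S) = Vt S"
  "parent (set_limit l u v S) = parent S" "label (set_limit l u v S) = label S"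
  "ptr (set_limit l u v S) = ptr S" "flow (set_limit l u v S) = flow S"
  "orphans (set_limit l u v S) = orphans S"
  by (simp_all add: set_limit_def)

lemma add_excess_simps [simp]:
  "net (add_excess u g S) = net S" "Vt (add_excess u g S) = Vt S"
  "parent (add_excess u g S) = parent S" "label (add_excess u g S) = label S"
  "ptr (add_excess u g S) = ptr S" "flow (add_excess u g S) = flow S"
  "limit (add_excess u g S) = limit S" "orphans (add_excess u g S) = orphans S"
  by (simp_all add: add_excess_def)

lemma set_flow_simps [simp]:
  "net (set_flow u v g S) = net S" "Vt (set_flow u v g S) = Vt S"
  "parent (set_flow u v g S) = parent S" "label (set_flow u v g S) = label S"
  "ptr (set_flow u v g S) = ptr S"
  "flow (set_flow u v g S) = (flow S)((u, v) := g, (v, u) := (\<lambda>x. - g x))"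
  "limit (set_flow u v g S) = limit S" "orphans (set_flow u v g S) = orphans S"
  by (simp_all add: set_flow_def)

lemma merge_unaffected:
  assumes "(u, v) \<in> E" "u \<noteq> s" "v \<noteq> s" "u \<notin> U" "v \<notin> U"
  shows "merge s U E g (u, v) = g (u, v)"
proof -
  have "{e' \<in> E. redirect s U e' = (u, v)} = {(u, v)}"
    using assms by (auto simp: redirect_def split: if_splits)
  then show ?thesis
    by (simp add: merge_def)
qed

lemma contract_simps [simp]:
  "Vt (contract U S) = Vt S" "parent (contract U S) = parent S" "label (contract U S) = label S"
  "ptr (contract U S) = ptr S" "limit (contract U S) = limit S" "orphans (contract U S) = orphans S"
  "source (net (contract U S)) = source (net S)" "sink (net (contract U S)) = sink (net S)"
  "lam_min (net (contract U S)) = lam_min (net S)"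
  by (simp_all add: contract_def Let_def)

text \<open>Merging only concerns edges that end up incident to the source. As \<open>s\<close>
  stays outside \<open>Vt\<close>, everything between vertices of \<open>Vt\<close> can be read off
  the original network throughout.\<close>

lemma contract_unaffected:
  assumes "(u, v) \<in> edges (net S)" "u \<noteq> source (net S)" "v \<noteq> source (net S)" "u \<notin> U" "v \<notin> U"
  shows "(u, v) \<in> edges (net (contract U S))"
    and "cap (net (contract U S)) (u, v) = cap (net S) (u, v)"
    and "flow (contract U S) (u, v) = flow S (u, v)"
proof -
  have "redirect (source (net S)) U (u, v) = (u, v)"
    using assms by (simp add: redirect_def)
  then have "(u, v) \<in> redirect (source (net S)) U ` edges (net S)"
    using assms(1) by (metis image_eqI)
  with assms show "(u, v) \<in> edges (net (contract U S))"
    by (simp add: contract_def Let_def)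
qed (simp_all add: contract_def Let_def merge_unaffected assms)

text \<open>Only meaningful for finite labels; \<open>shape\<close> guarantees these on
  \<open>Vt\<close>.\<close>

definition lab :: "'v pbfs \<Rightarrow> 'v \<Rightarrow> nat" where
  "lab S u = the_enat (label S u)"

lemma lab_contract [simp]: "lab (contract U S) = lab S"
  by (simp add: lab_def fun_eq_iff)

section \<open>The input graph and its adjacency lists\<close>

locale pbfs_input =
  fixes A :: "('v, real) network \<Rightarrow> ('v \<times> 'v \<Rightarrow> real) comp"
    and G :: "'v parametric_network"
    and vs :: "'v list"
    and adj :: "'v \<Rightarrow> ('v \<times> 'v) list"
  assumes algorithm: "maximum_flow_algorithm A"
    and network: "parametric_flow_network G"
    and monotone: "source_sink_monotone G"
    and lists: "represents vs adj G"
begin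

abbreviation "s \<equiv> source G"
abbreviation "t \<equiv> sink G"
abbreviation "E \<equiv> edges G"
abbreviation "range_lam \<equiv> {lam_min G..lam_max G}"
abbreviation "deg u \<equiv> length (adj u)"
abbreviation "n \<equiv> card (verts G)"

lemma lam_min_in_range: "lam_min G \<in> range_lam"
  using network by (simp add: parametric_flow_network_def)

lemma network_at_flow_network: "l \<in> range_lam \<Longrightarrow> flow_network (network_at G l)"
  using network by (simp add: parametric_flow_network_def)

lemma graph:
  shows finite_verts: "finite (verts G)"
    and edges_subset: "E \<subseteq> verts G \<times> verts G"
    and edges_sym: "(u, v) \<in> E \<Longrightarrow> (v, u) \<in> E"
    and source_in_verts: "s \<in> verts G"
    and sink_in_verts: "t \<in> verts G"
    and source_neq_sink: "s \<noteq> t"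
  using network_at_flow_network[OF lam_min_in_range]
  by (auto simp: flow_network_def network_at_def sym_def)

lemma finite_edges: "finite E"
  using finite_verts edges_subset by (blast intro: finite_subset[OF _ finite_cartesian_product])

lemma n_ge_2: "2 \<le> n"
proof -
  have "card {s, t} \<le> n"
    using finite_verts source_in_verts sink_in_verts by (intro card_mono) auto
  with source_neq_sink show ?thesis
    by simp
qed

lemma vertex_list: "distinct vs" "set vs = verts G" "length vs = n"
  using lists by (auto simp: represents_def distinct_card[symmetric])

lemma adj_iff: "u \<in> verts G \<Longrightarrow> e \<in> set (adj u) \<longleftrightarrow> e \<in> E \<and> fst e = u \<and> snd e \<noteq> u"
  using lists by (cases e) (auto simp: represents_def)

lemma adj_nth:
  assumes "u \<in> verts G" "i < deg u"
  shows "adj u ! i \<in> E" "fst (adj u ! i) = u" "snd (adj u ! i) \<noteq> u"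
  using adj_iff[OF assms(1), of "adj u ! i"] nth_mem[OF assms(2)] by auto

lemma distinct_adj: "u \<in> verts G \<Longrightarrow> distinct (adj u)"
  using lists by (simp add: represents_def)

text \<open>Lists of different vertices are disjoint, having different tails; equality fails only
  because of loops, which the lists omit.\<close>

lemma sum_deg_le: "(\<Sum>u\<in>verts G. deg u) \<le> card E"
proof -
  have "deg u = card (set (adj u))" if "u \<in> verts G" for u
    using distinct_adj[OF that] by (simp add: distinct_card)
  then have "(\<Sum>u\<in>verts G. deg u) = card (\<Union>u\<in>verts G. set (adj u))"
    using finite_verts adj_iff by (subst card_UN_disjoint) auto
  also have "\<dots> \<le> card E"
    using finite_edges adj_iff by (intro card_mono) auto
  finally show ?thesis .
qed

lemma constant_cap:
  assumes "(u, v) \<in> E" "u \<noteq> s" "v \<noteq> t" "x \<in> range_lam" "y \<in> range_lam"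
  shows "cap G (u, v) x = cap G (u, v) y"
proof -
  have *: "\<not> (u = s \<and> v \<noteq> t)" "\<not> (v = t \<and> u \<noteq> s)"
    using assms(2,3) by auto
  show ?thesis
    using bspec[OF monotone[unfolded source_sink_monotone_def] assms(1),
        unfolded prod.case if_not_P[OF *(1)] if_not_P[OF *(2)]] assms(4,5)
    by blast
qed

section \<open>The components of the invariant\<close>

text \<open>Residual capacity as a function of the parameter, taken with the uncontracted
  capacities; inside \<open>Vt\<close> it decides \<open>residual\<close> (see
  \<open>residual_iff_slack\<close>).\<close>

definition slack :: "'v pbfs \<Rightarrow> 'v \<times> 'v \<Rightarrow> real \<Rightarrow> real" where
  "slack S e x = cap G e x - flow S e x"

text \<open>Nonempty adjacency lists ensure that every orphan belongs to \<open>active\<close>, the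
  vertices over which the potential is summed.\<close>

definition shape :: "'v pbfs \<Rightarrow> bool" where
  "shape S \<longleftrightarrow> Vt S \<subseteq> verts G \<and> t \<in> Vt S \<and> s \<notin> Vt S \<and> source (net S) = s \<and> lab S t = 0 \<and>
     (\<forall>u\<in>Vt S. label S u = enat (lab S u) \<and> lab S u < n) \<and> (\<forall>u\<in>Vt S - {t}. adj u \<noteq> []) \<and>
     (\<forall>u\<in>Vt S. \<forall>v\<in>Vt S. (u, v) \<in> E \<longrightarrow> (u, v) \<in> edges (net S) \<and> cap (net S) (u, v) = cap G (u, v))"

definition tree :: "'v pbfs \<Rightarrow> bool" where
  "tree S \<longleftrightarrow> (\<forall>u v. parent S u = Some v \<longrightarrow>
     u \<in> Vt S \<and> u \<noteq> t \<and> v \<in> Vt S \<and> (u, v) \<in> E \<and> lab S u = lab S v + 1)"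

text \<open>\<open>X\<close> contains the orphan in progress: already taken out of
  \<open>orphans\<close>, but still without a parent.\<close>

definition orphans_except :: "'v set \<Rightarrow> 'v pbfs \<Rightarrow> bool" where
  "orphans_except X S \<longleftrightarrow> orphans S = {u \<in> Vt S - {t}. parent S u = None} - X"

text \<open>Being a root of the slack is what makes a tree edge non-residual when it is removed at
  its flow limit.\<close>

definition limits :: "'v pbfs \<Rightarrow> bool" where
  "limits S \<longleftrightarrow> (\<forall>u v. limit S (u, v) \<noteq> \<infinity> \<longrightarrow> parent S u = Some v \<and>
     (\<exists>x\<ge>lam_min G. limit S (u, v) = ereal x \<and> slack S (u, v) x = 0))"

text \<open>Tails at \<open>t\<close> are exempt: the flow on an edge out of \<open>t\<close> is
  minus the flow into \<open>t\<close>, which may follow a decreasing capacity. Such edges do no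
  harm because \<open>t\<close> has label 0.\<close>

definition frozen :: "'v pbfs \<Rightarrow> bool" where
  "frozen S \<longleftrightarrow> (\<forall>u\<in>Vt S - {t}. \<forall>v\<in>Vt S. (u, v) \<in> E \<longrightarrow> u \<noteq> v \<longrightarrow>
     parent S u \<noteq> Some v \<longrightarrow> parent S v \<noteq> Some u \<longrightarrow>
     (\<forall>x\<in>range_lam. \<forall>y\<in>range_lam. slack S (u, v) x = slack S (u, v) y))"

definition valid :: "real \<Rightarrow> 'v pbfs \<Rightarrow> bool" where
  "valid l S \<longleftrightarrow> (\<forall>u\<in>Vt S. \<forall>v\<in>Vt S. (u, v) \<in> E \<longrightarrow> u \<noteq> v \<longrightarrow>
     slack S (u, v) l > 0 \<longrightarrow> lab S u \<le> lab S v + 1)"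

text \<open>Given \<open>valid\<close>, this is the negation of admissibility. The inequality, in
  place of a mere failure of \<open>d(u) = d(v) + 1\<close>, persists when the label of the head
  grows.\<close>

definition dead :: "real \<Rightarrow> 'v pbfs \<Rightarrow> 'v \<times> 'v \<Rightarrow> bool" where
  "dead l S e \<longleftrightarrow> (snd e \<in> Vt S \<longrightarrow> slack S e l > 0 \<longrightarrow> lab S (fst e) \<le> lab S (snd e))"

text \<open>
  The ghost pointer \<open>D u\<close> exceeds the current-edge pointer by one if the tree edge of \<open>u\<close>
  is, or was when \<open>u\<close> became an orphan, the current edge. After a relabel the tree edge
  need not be the current edge. Heads in \<open>X\<close> are about to be relabeled or contracted.
\<close>

definition pointers :: "real \<Rightarrow> 'v set \<Rightarrow> ('v \<Rightarrow> nat) \<Rightarrow> 'v pbfs \<Rightarrow> bool" where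
  "pointers l X D S \<longleftrightarrow> (\<forall>u\<in>Vt S - {t}. ptr S u \<le> deg u \<and> ptr S u \<le> D u \<and> D u \<le> Suc (ptr S u) \<and>
     (\<forall>v. parent S u = Some v \<longrightarrow>
        (D u \<noteq> ptr S u \<longrightarrow> ptr S u < deg u \<and> adj u ! ptr S u = (u, v)) \<and>
        (\<forall>i<ptr S u. adj u ! i \<noteq> (u, v) \<and> dead l S (adj u ! i))) \<and>
     (parent S u = None \<longrightarrow>
        (\<forall>i<D u. i < deg u \<longrightarrow> dead l S (adj u ! i) \<or> snd (adj u ! i) \<in> X)))"

definition inv :: "real \<Rightarrow> 'v set \<Rightarrow> ('v \<Rightarrow> nat) \<Rightarrow> 'v pbfs \<Rightarrow> bool" where
  "inv l X D S \<longleftrightarrow> shape S \<and> tree S \<and> orphans_except X S \<and> limits S \<and> frozen S \<and> valid l S \<and>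
     pointers l X D S"

lemma unaffected_simps [simp]:
  "slack (ptr_update a S) = slack S" "slack (orphans_update b S) = slack S"
  "slack (parent_update c S) = slack S" "slack (Vt_update d S) = slack S"
  "slack (beta_update e S) = slack S" "slack (label_update f S) = slack S"
  "slack (limit_update g S) = slack S"
  "lab (ptr_update a S) = lab S" "lab (orphans_update b S) = lab S"
  "lab (parent_update c S) = lab S" "lab (Vt_update d S) = lab S"
  "lab (beta_update e S) = lab S" "lab (limit_update g S) = lab S"
  "lab (S\<lparr>label := (label S')(p := enat k)\<rparr>) = (lab S')(p := k)"
  by (simp_all add: slack_def lab_def fun_eq_iff)

lemma unaffected_dead [simp]:
  "dead l (ptr_update a S) = dead l S" "dead l (orphans_update b S) = dead l S"
  "dead l (parent_update c S) = dead l S"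
  by (simp_all add: dead_def fun_eq_iff)

lemma treeD:
  assumes "tree S" "parent S u = Some v"
  shows "u \<in> Vt S" "u \<noteq> t" "v \<in> Vt S" "(u, v) \<in> E" "lab S u = lab S v + 1" "u \<noteq> v"
    "parent S v \<noteq> Some u"
proof -
  show "u \<noteq> v"
    using assms unfolding tree_def by (metis n_not_Suc_n Suc_eq_plus1)
  show "parent S v \<noteq> Some u"
  proof
    assume "parent S v = Some u"
    then have "lab S v = lab S u + 1"
      using assms(1) by (simp add: tree_def)
    moreover have "lab S u = lab S v + 1"
      using assms by (simp add: tree_def)
    ultimately show False
      by simp
  qed
qed (use assms in \<open>auto simp: tree_def\<close>)

lemma frozenD:
  assumes "frozen S" "u \<in> Vt S" "u \<noteq> t" "v \<in> Vt S" "(u, v) \<in> E" "u \<noteq> v"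
    "parent S u \<noteq> Some v" "parent S v \<noteq> Some u" "x \<in> range_lam" "y \<in> range_lam"
  shows "slack S (u, v) x = slack S (u, v) y"
  using assms unfolding frozen_def by blast

lemma frozen_cong:
  assumes "frozen S" "Vt S' = Vt S" "parent S' = parent S" "slack S' = slack S"
  shows "frozen S'"
  using assms(1) unfolding frozen_def assms(2-4) .

lemma validD:
  assumes "valid l S" "u \<in> Vt S" "v \<in> Vt S" "(u, v) \<in> E" "u \<noteq> v" "slack S (u, v) l > 0"
  shows "lab S u \<le> lab S v + 1"
  using assms unfolding valid_def by blast

lemma residual_iff_slack:
  "shape S \<Longrightarrow> u \<in> Vt S \<Longrightarrow> v \<in> Vt S \<Longrightarrow> (u, v) \<in> E \<Longrightarrow> residual l S (u, v) \<longleftrightarrow> slack S (u, v) l > 0"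
  by (simp add: shape_def residual_def slack_def)

lemma dead_mono:
  assumes "dead l S e" "slack S' e l = slack S e l \<or> lab S' (fst e) \<le> lab S' (snd e)"
    "Vt S' \<subseteq> Vt S" "lab S' (fst e) = lab S (fst e)" "lab S (snd e) \<le> lab S' (snd e)"
  shows "dead l S' e"
  using assms by (auto simp: dead_def)

section \<open>Changes along tree edges and of the parameter\<close>

text \<open>
  Changing the flow on a tree edge \<open>(u, v)\<close> is harmless: the labels differ by exactly one,
  and the reverse edge leads from the smaller label to the larger one.
\<close>

lemma inv_tree_flow:
  assumes S: "inv l X D S" and p: "parent S u = Some v"
    and same: "net S' = net S" "Vt S' = Vt S" "parent S' = parent S" "label S' = label S"
      "ptr S' = ptr S" "orphans S' = orphans S"
    and flow: "flow S' = (flow S)((u, v) := g, (v, u) := h)"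
    and limit: "limit S' = (limit S)((u, v) := smallest_root (slack S' (u, v)) l')"
    and l': "lam_min G \<le> l'"
  shows "inv l X D S'"
proof -
  have S': "shape S" "tree S" "orphans_except X S" "limits S" "frozen S" "valid l S" "pointers l X D S"
    using S by (auto simp: inv_def)
  note uv = treeD[OF S'(2) p]
  have lab: "lab S' = lab S"
    by (simp add: lab_def fun_eq_iff same)
  have slack: "slack S' e = slack S e" if "e \<noteq> (u, v)" "e \<noteq> (v, u)" for e
    using that by (auto simp: slack_def flow)
  \<comment> \<open>The tree edge itself is excepted, since it may regain residual capacity. By
    \<open>pointers\<close> it does not occur before the current edge of \<open>u\<close>, and lists
    of other vertices contain no edge with tail \<open>u\<close>.\<close>
  have dead: "dead l S' e" if "dead l S e" "e \<noteq> (u, v)" for e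
    using that(1)
  proof (rule dead_mono)
    show "slack S' e l = slack S e l \<or> lab S' (fst e) \<le> lab S' (snd e)"
      using slack[of e] that(2) uv(5) lab by (cases "e = (v, u)") auto
  qed (simp_all add: lab same)
  have "limits S'"
    unfolding limits_def
  proof (intro allI impI)
    fix a b assume ab: "limit S' (a, b) \<noteq> \<infinity>"
    show "parent S' a = Some b \<and> (\<exists>x\<ge>lam_min G. limit S' (a, b) = ereal x \<and> slack S' (a, b) x = 0)"
    proof (cases "(a, b) = (u, v)")
      case True
      then show ?thesis
        using ab smallest_root_cases[of "slack S' (u, v)" l'] l' p by (force simp: limit same)
    next
      case False
      then have "limit S (a, b) \<noteq> \<infinity>"
        using ab by (auto simp: limit split: if_splits)
      then have "parent S a = Some b" "\<exists>x\<ge>lam_min G. limit S (a, b) = ereal x \<and> slack S (a, b) x = 0"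
        using S'(4) by (auto simp: limits_def)
      moreover have "(a, b) \<noteq> (v, u)"
        using calculation(1) uv(7) by auto
      ultimately show ?thesis
        using False by (auto simp: slack limit same)
    qed
  qed
  moreover have "frozen S'"
    unfolding frozen_def
  proof (intro ballI impI)
    fix a b x y
    assume ab: "a \<in> Vt S' - {t}" "b \<in> Vt S'" "(a, b) \<in> E" "a \<noteq> b"
      "parent S' a \<noteq> Some b" "parent S' b \<noteq> Some a" and xy: "x \<in> range_lam" "y \<in> range_lam"
    then have "(a, b) \<noteq> (u, v)" "(a, b) \<noteq> (v, u)"
      using p by (auto simp: same)
    then show "slack S' (a, b) x = slack S' (a, b) y"
      using frozenD[OF S'(5) _ _ _ ab(3,4) _ _ xy] ab by (simp add: slack same)
  qed
  moreover have "valid l S'"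
    unfolding valid_def same lab
  proof (intro ballI impI)
    fix a b assume "a \<in> Vt S" "b \<in> Vt S" "(a, b) \<in> E" "a \<noteq> b" "slack S' (a, b) l > 0"
    then show "lab S a \<le> lab S b + 1"
      using S'(6) uv(5) slack[of "(a, b)"] by (cases "(a, b) = (u, v) \<or> (a, b) = (v, u)") (auto simp: valid_def)
  qed
  moreover have "pointers l X D S'"
    unfolding pointers_def same
  proof (intro ballI)
    fix w assume w: "w \<in> Vt S - {t}"
    show "ptr S w \<le> deg w \<and> ptr S w \<le> D w \<and> D w \<le> Suc (ptr S w) \<and>
     (\<forall>v. parent S w = Some v \<longrightarrow>
        (D w \<noteq> ptr S w \<longrightarrow> ptr S w < deg w \<and> adj w ! ptr S w = (w, v)) \<and>
        (\<forall>i<ptr S w. adj w ! i \<noteq> (w, v) \<and> dead l S' (adj w ! i))) \<and>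
     (parent S w = None \<longrightarrow>
        (\<forall>i<D w. i < deg w \<longrightarrow> dead l S' (adj w ! i) \<or> snd (adj w ! i) \<in> X))"
    proof (cases "w = u")
      case True
      then show ?thesis
        using S'(7) w p dead unfolding pointers_def by auto
    next
      case False
      then have "adj w ! i \<noteq> (u, v)" if "i < deg w" for i
        using adj_nth(2)[of w i] that w S'(1) by (auto simp: shape_def)
      then show ?thesis
        using S'(7) w dead unfolding pointers_def by (meson order_less_le_trans)
    qed
  qed
  ultimately show ?thesis
    using S' by (simp add: inv_def shape_def tree_def orphans_except_def same lab)
qed

lemma inv_set_limit:
  assumes "inv l X D S" "parent S u = Some v" "lam_min G \<le> l'"
  shows "inv l X D (set_limit l' u v S)"
proof (rule inv_tree_flow[OF assms(1,2)])
  have "cap (net S) (u, v) = cap G (u, v)"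
    using assms treeD[of S u v] by (simp add: inv_def shape_def)
  then show "limit (set_limit l' u v S) =
      (limit S)((u, v) := smallest_root (slack (set_limit l' u v S) (u, v)) l')"
    by (simp add: set_limit_def slack_def[abs_def])
  show "flow (set_limit l' u v S) = (flow S)((u, v) := flow S (u, v), (v, u) := flow S (v, u))"
    by (simp add: set_limit_def)
qed (simp_all add: set_limit_def assms(3))

text \<open>Since there are no orphans, the drained vertex has a parent and the choice of its tree
  edge cannot get stuck. The rest is an instance of \<open>inv_tree_flow\<close>.\<close>

lemma drain_vertex_inv:
  assumes S: "inv l {} D S" "orphans S = {}" and u: "u \<in> Vt S - {t}" and l: "lam_min G \<le> l"
  shows "post (drain_vertex l u S) (\<lambda>S' k. inv l {} D S' \<and> orphans S' = {} \<and> Vt S' = Vt S \<and>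
           label S' = label S \<and> k = 0)"
proof (cases "u \<in> modified S")
  case False
  then show ?thesis
    using assms by (simp add: drain_vertex_def)
next
  case True
  have "\<exists>v. parent S u = Some v"
    using S u by (auto simp: inv_def orphans_except_def)
  moreover have "inv l {} D (set_limit l u v (S'\<lparr>excess := e, modified := m\<rparr>))"
    if S': "S' = add_excess v y (set_flow u v g S)" and p: "parent S u = Some v" for v S' y g e m
  proof (rule inv_tree_flow[OF S(1) p])
    have "cap (net S) (u, v) = cap G (u, v)"
      using S treeD[of S u v] p by (simp add: inv_def shape_def)
    then show "limit (set_limit l u v (S'\<lparr>excess := e, modified := m\<rparr>)) =
      (limit S)((u, v) := smallest_root (slack (set_limit l u v (S'\<lparr>excess := e, modified := m\<rparr>)) (u, v)) l)"
      by (simp add: set_limit_def slack_def[abs_def] S')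
    show "flow (set_limit l u v (S'\<lparr>excess := e, modified := m\<rparr>)) =
      (flow S)((u, v) := g, (v, u) := \<lambda>x. - g x)"
      by (simp add: S')
  qed (simp_all add: l S')
  ultimately show ?thesis
    using True S(2) unfolding drain_vertex_def
    by (auto intro!: post_bind simp: Let_def)
qed

text \<open>An edge inside \<open>Vt\<close> whose slack differs at \<open>l\<close> and
  \<open>l'\<close> is a tree edge, the reverse of one, or leaves \<open>t\<close>. In the last two
  cases the label does not drop along it, so it is dead whatever its slack. A tree edge meets the
  label bound with equality, and \<open>pointers\<close> keeps it away from the edges already
  scanned.\<close>

lemma inv_change_lambda:
  assumes S: "inv l {} D S" "orphans S = {}" and l: "l \<in> range_lam" "l' \<in> range_lam"
  shows "inv l' {} D S"
proof -
  have S': "shape S" "tree S" "orphans_except {} S" "limits S" "frozen S" "valid l S" "pointers l {} D S"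
    using S by (auto simp: inv_def)
  have attached: "parent S u \<noteq> None" if "u \<in> Vt S - {t}" for u
    using S'(3) S(2) that by (auto simp: orphans_except_def)
  have const: "slack S (u, v) l = slack S (u, v) l' \<or> parent S u = Some v \<or> lab S u \<le> lab S v"
    if "u \<in> Vt S" "v \<in> Vt S" "(u, v) \<in> E" "u \<noteq> v" for u v
  proof (cases "u = t \<or> parent S v = Some u")
    case True
    then show ?thesis
      using S'(1) treeD(5)[OF S'(2), of v u] by (auto simp: shape_def)
  next
    case False
    then show ?thesis
      using S'(5) that l unfolding frozen_def by blast
  qed
  have "valid l' S"
    unfolding valid_def
  proof (intro ballI impI)
    fix u v assume uv: "u \<in> Vt S" "v \<in> Vt S" "(u, v) \<in> E" "u \<noteq> v" "slack S (u, v) l' > 0"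
    with S'(6) const[OF uv(1-4)] treeD(5)[OF S'(2), of u v] show "lab S u \<le> lab S v + 1"
      unfolding valid_def by fastforce
  qed
  moreover have "pointers l' {} D S"
    unfolding pointers_def
  proof (intro ballI)
    fix u assume u: "u \<in> Vt S - {t}"
    then obtain v where v: "parent S u = Some v"
      using attached by blast
    have *: "dead l' S (adj u ! i)" if i: "dead l S (adj u ! i)" "adj u ! i \<noteq> (u, v)" "i < deg u" for i
      unfolding dead_def
    proof (intro impI)
      obtain w where w: "adj u ! i = (u, w)" "(u, w) \<in> E" "u \<noteq> w"
        using adj_nth[of u i] i(3) u S'(1) by (cases "adj u ! i") (auto simp: shape_def)
      assume "snd (adj u ! i) \<in> Vt S" "0 < slack S (adj u ! i) l'"
      then show "lab S (fst (adj u ! i)) \<le> lab S (snd (adj u ! i))"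
        using const[of u w] w i(1,2) u v by (auto simp: dead_def)
    qed
    show "ptr S u \<le> deg u \<and> ptr S u \<le> D u \<and> D u \<le> Suc (ptr S u) \<and>
     (\<forall>v. parent S u = Some v \<longrightarrow>
        (D u \<noteq> ptr S u \<longrightarrow> ptr S u < deg u \<and> adj u ! ptr S u = (u, v)) \<and>
        (\<forall>i<ptr S u. adj u ! i \<noteq> (u, v) \<and> dead l' S (adj u ! i))) \<and>
     (parent S u = None \<longrightarrow>
        (\<forall>i<D u. i < deg u \<longrightarrow> dead l' S (adj u ! i) \<or> snd (adj u ! i) \<in> {}))"
      using bspec[OF S'(7)[unfolded pointers_def] u] v * by (auto dest: order_less_le_trans)
  qed
  ultimately show ?thesis
    using S' by (simp add: inv_def)
qed

text \<open>The hypothesis \<open>gone\<close> covers both uses: a saturated edge is dead from now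
  on, whereas the edge from a child to the orphan in progress may still be residual and is excused
  by \<open>X\<close>. Either way the ghost pointer of \<open>u\<close> may keep counting the former
  tree edge as scanned.\<close>

lemma inv_remove_tree_edge:
  assumes S: "inv l X D S" and p: "parent S u = Some v" and l: "l \<in> range_lam"
    and u: "u \<notin> X" and gone: "slack S (u, v) l \<le> 0 \<or> v \<in> X"
  shows "inv l X D (remove_tree_edge l u v S)"
proof -
  let ?S = "remove_tree_edge l u v S"
  have S': "shape S" "tree S" "orphans_except X S" "limits S" "frozen S" "valid l S" "pointers l X D S"
    using S by (auto simp: inv_def)
  note uv = treeD[OF S'(2) p]
  have caps: "cap (net S) (u, v) = cap G (u, v)" and s: "u \<noteq> s" "v \<noteq> s"
    using S'(1) uv by (auto simp: shape_def)
  have lab: "lab ?S = lab S"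
    by (simp add: lab_def fun_eq_iff)
  have slack: "slack ?S e = slack S e" if "e \<noteq> (u, v)" "e \<noteq> (v, u)" for e
    using that by (auto simp: slack_def flow_remove_tree_edge)
  \<comment> \<open>The new flow function is the capacity shifted by a constant, so the edge becomes
    frozen at the moment it leaves the tree.\<close>
  have slack_uv: "slack ?S (u, v) x = slack S (u, v) l" for x
    using uv(6) by (simp add: slack_def flow_remove_tree_edge caps)
  have dead: "dead l ?S e" if "dead l S e" for e
    using that
  proof (rule dead_mono)
    show "slack ?S e l = slack S e l \<or> lab ?S (fst e) \<le> lab ?S (snd e)"
    proof (cases "e = (u, v) \<or> e = (v, u)")
      case True
      then show ?thesis
        using slack_uv uv(5) by (auto simp: lab)
    qed (use slack[of e] in simp)
  qed (simp_all add: lab)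
  have "limits ?S"
    unfolding limits_def
  proof (intro allI impI)
    fix a b assume "limit ?S (a, b) \<noteq> \<infinity>"
    then have ab: "limit S (a, b) \<noteq> \<infinity>" "(a, b) \<noteq> (u, v)"
      by (auto split: if_splits)
    then have "parent S a = Some b" "\<exists>x\<ge>lam_min G. limit S (a, b) = ereal x \<and> slack S (a, b) x = 0"
      using S'(4) by (auto simp: limits_def)
    moreover have "(a, b) \<noteq> (v, u)"
      using calculation(1) uv(7) by auto
    ultimately show "parent ?S a = Some b \<and>
        (\<exists>x\<ge>lam_min G. limit ?S (a, b) = ereal x \<and> slack ?S (a, b) x = 0)"
      using ab p by (auto simp: slack)
  qed
  moreover have "frozen ?S"
    unfolding frozen_def
  proof (intro ballI impI)
    fix a b x y
    assume ab: "a \<in> Vt ?S - {t}" "b \<in> Vt ?S" "(a, b) \<in> E" "a \<noteq> b"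
      "parent ?S a \<noteq> Some b" "parent ?S b \<noteq> Some a" and xy: "x \<in> range_lam" "y \<in> range_lam"
    consider "(a, b) = (u, v)" | "(a, b) = (v, u)" | "(a, b) \<noteq> (u, v)" "(a, b) \<noteq> (v, u)"
      by blast
    then show "slack ?S (a, b) x = slack ?S (a, b) y"
    proof cases
      \<comment> \<open>The reverse edge. Its tail \<open>v\<close> is not \<open>t\<close> here, so
        neither end is \<open>s\<close> or \<open>t\<close> and the capacities of both directions
        are constant.\<close>
      case 2
      then have "cap G (u, v) x = cap G (u, v) y" "cap G (v, u) x = cap G (v, u) y"
        using ab(1,3) xy uv s by (auto intro!: constant_cap)
      with 2 uv(6) show ?thesis
        by (simp add: slack_def flow_remove_tree_edge caps)
    next
      case 3
      have "parent S a \<noteq> Some b" "parent S b \<noteq> Some a"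
        using 3 ab p by (auto split: if_splits)
      then show ?thesis
        using frozenD[OF S'(5) _ _ _ ab(3,4) _ _ xy] ab(1,2) by (simp add: slack[OF 3])
    qed (simp add: slack_uv)
  qed
  moreover have "valid l ?S"
    unfolding valid_def lab
  proof (intro ballI impI)
    fix a b assume ab: "a \<in> Vt ?S" "b \<in> Vt ?S" "(a, b) \<in> E" "a \<noteq> b" "slack ?S (a, b) l > 0"
    show "lab S a \<le> lab S b + 1"
    proof (cases "(a, b) = (u, v) \<or> (a, b) = (v, u)")
      case True
      with uv(5) show ?thesis
        by auto
    next
      case False
      with ab validD[OF S'(6) _ _ ab(3,4)] slack[of "(a, b)"] show ?thesis
        by auto
    qed
  qed
  moreover have "pointers l X D ?S"
    unfolding pointers_def
  proof (intro ballI)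
    fix w assume w: "w \<in> Vt ?S - {t}"
    show "ptr ?S w \<le> deg w \<and> ptr ?S w \<le> D w \<and> D w \<le> Suc (ptr ?S w) \<and>
     (\<forall>v. parent ?S w = Some v \<longrightarrow>
        (D w \<noteq> ptr ?S w \<longrightarrow> ptr ?S w < deg w \<and> adj w ! ptr ?S w = (w, v)) \<and>
        (\<forall>i<ptr ?S w. adj w ! i \<noteq> (w, v) \<and> dead l ?S (adj w ! i))) \<and>
     (parent ?S w = None \<longrightarrow>
        (\<forall>i<D w. i < deg w \<longrightarrow> dead l ?S (adj w ! i) \<or> snd (adj w ! i) \<in> X))"
    proof (cases "w = u")
      case True
      have u: "ptr S u \<le> deg u" "ptr S u \<le> D u" "D u \<le> Suc (ptr S u)"
        "D u \<noteq> ptr S u \<Longrightarrow> adj u ! ptr S u = (u, v)"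
        "\<And>i. i < ptr S u \<Longrightarrow> dead l S (adj u ! i)"
        using S'(7) uv(1,2) p unfolding pointers_def by auto
      \<comment> \<open>The ghost pointer is at most one ahead, so the only position not below the
        current-edge pointer is that of the removed edge itself.\<close>
      have "dead l ?S (adj u ! i) \<or> snd (adj u ! i) \<in> X" if "i < D u" for i
      proof (cases "i < ptr S u")
        case False
        then have "adj u ! i = (u, v)"
          using u that by (metis le_less_Suc_eq less_SucE not_less order_less_le_trans)
        with gone slack_uv show ?thesis
          by (auto simp: dead_def)
      qed (use u(5) dead in blast)
      with u True show ?thesis
        by simp
    next
      case False
      then show ?thesis
        using bspec[OF S'(7)[unfolded pointers_def], of w] w by (simp add: dead) (blast intro: dead)
    qed
  qed
  moreover have "shape ?S"
    using S'(1) by (simp add: shape_def lab)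
  moreover have "tree ?S"
    using S'(2) by (simp add: tree_def lab)
  moreover have "orphans_except X ?S"
    using S'(3) uv u by (auto simp: orphans_except_def)
  ultimately show ?thesis
    by (simp add: inv_def)
qed

lemma invD:
  assumes "inv l X D S"
  shows "shape S" "tree S" "orphans_except X S" "limits S" "frozen S" "valid l S" "pointers l X D S"
  using assms by (simp_all add: inv_def)

lemma pointersD:
  assumes "pointers l X D S" "u \<in> Vt S" "u \<noteq> t"
  shows "ptr S u \<le> deg u" "ptr S u \<le> D u" "D u \<le> Suc (ptr S u)"
    "\<And>v. parent S u = Some v \<Longrightarrow> D u \<noteq> ptr S u \<Longrightarrow> ptr S u < deg u \<and> adj u ! ptr S u = (u, v)"
    "\<And>v i. parent S u = Some v \<Longrightarrow> i < ptr S u \<Longrightarrow> adj u ! i \<noteq> (u, v) \<and> dead l S (adj u ! i)"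
    "\<And>i. parent S u = None \<Longrightarrow> i < D u \<Longrightarrow> i < deg u \<Longrightarrow> dead l S (adj u ! i) \<or> snd (adj u ! i) \<in> X"
  using assms unfolding pointers_def by blast+

lemma pointersI:
  assumes "\<And>u. u \<in> Vt S \<Longrightarrow> u \<noteq> t \<Longrightarrow> ptr S u \<le> deg u \<and> ptr S u \<le> D u \<and> D u \<le> Suc (ptr S u)"
    "\<And>u v. u \<in> Vt S \<Longrightarrow> u \<noteq> t \<Longrightarrow> parent S u = Some v \<Longrightarrow> D u \<noteq> ptr S u \<Longrightarrow>
       ptr S u < deg u \<and> adj u ! ptr S u = (u, v)"
    "\<And>u v i. u \<in> Vt S \<Longrightarrow> u \<noteq> t \<Longrightarrow> parent S u = Some v \<Longrightarrow> i < ptr S u \<Longrightarrow>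
       adj u ! i \<noteq> (u, v) \<and> dead l S (adj u ! i)"
    "\<And>u i. u \<in> Vt S \<Longrightarrow> u \<noteq> t \<Longrightarrow> parent S u = None \<Longrightarrow> i < D u \<Longrightarrow> i < deg u \<Longrightarrow>
       dead l S (adj u ! i) \<or> snd (adj u ! i) \<in> X"
  shows "pointers l X D S"
  using assms unfolding pointers_def by blast

lemma frozenI:
  assumes "\<And>u v x y. u \<in> Vt S \<Longrightarrow> u \<noteq> t \<Longrightarrow> v \<in> Vt S \<Longrightarrow> (u, v) \<in> E \<Longrightarrow> u \<noteq> v \<Longrightarrow>
    parent S u \<noteq> Some v \<Longrightarrow> parent S v \<noteq> Some u \<Longrightarrow> x \<in> range_lam \<Longrightarrow> y \<in> range_lam \<Longrightarrow>
    slack S (u, v) x = slack S (u, v) y"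
  shows "frozen S"
  using assms unfolding frozen_def by blast

lemma shape_in_verts: "shape S \<Longrightarrow> u \<in> Vt S \<Longrightarrow> u \<in> verts G"
  by (auto simp: shape_def)

text \<open>A parentless vertex has only infinite limits on its outgoing edges, so the new tree edge
  starts with limit \<open>\<infinity>\<close> and no root condition has to be checked for
  it.\<close>

lemma limits_attach:
  assumes "limits S" "parent S p = None" "parent S' = (parent S)(p := q)" "limit S' = limit S"
    "slack S' = slack S"
  shows "limits S'"
  unfolding limits_def
proof (intro allI impI)
  fix a b assume "limit S' (a, b) \<noteq> \<infinity>"
  then have "parent S a = Some b" "\<exists>x\<ge>lam_min G. limit S (a, b) = ereal x \<and> slack S (a, b) x = 0"
    using assms(1,4) by (auto simp: limits_def)
  with assms show "parent S' a = Some b \<and> (\<exists>x\<ge>lam_min G. limit S' (a, b) = ereal x \<and> slack S' (a, b) x = 0)"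
    by auto
qed

text \<open>
  The factor of the label pays for the reset of \<open>D u\<close> at a relabel and for the traversals of
  \<open>adj u\<close> at a relabel or contraction.
\<close>

definition weight :: "('v \<Rightarrow> nat) \<Rightarrow> 'v pbfs \<Rightarrow> 'v \<Rightarrow> nat" where
  "weight D S u = (if u \<in> Vt S then lab S u * (8 * (deg u + 1)) + D u else n * (8 * (deg u + 1)))"

text \<open>Vertices without listed edges are left out so that
  \<open>deg u + 1 \<le> 2 * deg u\<close>; otherwise the potential would only be bounded in terms
  of \<open>n * (n + card E)\<close>.\<close>

definition active :: "'v set" where
  "active = {u \<in> verts G - {t}. adj u \<noteq> []}"

definition potential :: "('v \<Rightarrow> nat) \<Rightarrow> 'v pbfs \<Rightarrow> nat" where
  "potential D S = (\<Sum>u\<in>active. weight D S u)"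

lemma potential_change:
  assumes "p \<in> active" "\<And>u. u \<noteq> p \<Longrightarrow> weight D' S' u = weight D S u"
  shows "potential D' S' + weight D S p = potential D S + weight D' S' p"
proof -
  have fin: "finite active"
    using finite_verts by (simp add: active_def)
  have "(\<Sum>u\<in>active - {p}. weight D' S' u) = (\<Sum>u\<in>active - {p}. weight D S u)"
    using assms(2) by (intro sum.cong) auto
  then show ?thesis
    by (simp add: potential_def sum.remove[OF fin assms(1)])
qed

text \<open>The label is at most \<open>n - 1\<close> and the ghost pointer at most
  \<open>deg u + 1\<close>, less than one more unit of label is worth. The weight of a contracted
  vertex is therefore an upper bound for all weights.\<close>

lemma weight_le:
  assumes "inv l X D S" "u \<in> active"
  shows "weight D S u \<le> n * (8 * (deg u + 1))"
proof (cases "u \<in> Vt S")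
  case True
  have "lab S u < n"
    using invD(1)[OF assms(1)] True by (simp add: shape_def)
  then have "(lab S u + 1) * (8 * (deg u + 1)) \<le> n * (8 * (deg u + 1))"
    by (intro mult_le_mono1) simp
  moreover have "D u \<le> deg u + 1"
    using pointersD(1,3)[OF invD(7)[OF assms(1)] True] assms(2) by (simp add: active_def)
  ultimately show ?thesis
    using True by (simp add: weight_def)
qed (simp add: weight_def)

lemma potential_le:
  assumes "inv l X D S"
  shows "potential D S \<le> 16 * n * card E"
proof -
  have fin: "finite active"
    using finite_verts by (simp add: active_def)
  have "weight D S u \<le> 16 * n * deg u" if "u \<in> active" for u
  proof -
    have "weight D S u \<le> n * (8 * (deg u + 1))"
      by (rule weight_le[OF assms that])
    also have "\<dots> \<le> n * (16 * deg u)"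
      using that by (intro mult_le_mono2) (cases "adj u"; simp add: active_def)
    finally show ?thesis
      by simp
  qed
  then have "potential D S \<le> (\<Sum>u\<in>active. 16 * n * deg u)"
    unfolding potential_def by (rule sum_mono)
  also have "\<dots> = 16 * n * (\<Sum>u\<in>active. deg u)"
    by (simp add: sum_distrib_left)
  also have "(\<Sum>u\<in>active. deg u) \<le> (\<Sum>u\<in>verts G. deg u)"
    using finite_verts by (intro sum_mono2) (auto simp: active_def)
  finally show ?thesis
    using sum_deg_le mult_le_mono2 le_trans by blast
qed

section \<open>Adoption, relabeling and contraction of an orphan\<close>

text \<open>The new tree edge is the current edge, so the ghost pointer moves one past it.
  Distinctness of the list shows that the edge does not also occur earlier.\<close>

lemma inv_adopt:
  assumes S: "inv l {} D S" and p: "p \<in> orphans S"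
    and i: "i < deg p" "ptr S p \<le> i" "\<And>j. j < i \<Longrightarrow> dead l S (adj p ! j)"
    and v: "snd (adj p ! i) \<in> Vt S" "lab S p = lab S (snd (adj p ! i)) + 1"
  shows "inv l {} (D(p := Suc i)) (S\<lparr>orphans := orphans S - {p}, ptr := (ptr S)(p := i),
           parent := (parent S)(p := Some (snd (adj p ! i)))\<rparr>)"
    (is "inv l {} ?D ?S")
proof -
  note S' = invD[OF S]
  have p': "p \<in> Vt S" "p \<noteq> t" "parent S p = None"
    using S'(3) p by (auto simp: orphans_except_def)
  note pV = shape_in_verts[OF S'(1) p'(1)]
  obtain w where w: "adj p ! i = (p, w)" "(p, w) \<in> E" "w \<noteq> p"
    using adj_nth[OF pV i(1)] by (cases "adj p ! i") auto
  have lab: "lab ?S = lab S" and slack: "slack ?S = slack S"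
    by (simp_all add: lab_def slack_def fun_eq_iff)
  have "shape ?S"
    using S'(1) by (simp add: shape_def lab)
  moreover have "tree ?S"
    using S'(2) p' v w by (simp add: tree_def lab)
  moreover have "orphans_except {} ?S"
    using S'(3) by (auto simp: orphans_except_def)
  moreover have "limits ?S"
    using S'(4) p'(3) by (rule limits_attach) (simp_all add: slack)
  moreover have "frozen ?S"
  proof (rule frozenI)
    fix a b x y
    assume "a \<in> Vt ?S" "a \<noteq> t" "b \<in> Vt ?S" "(a, b) \<in> E" "a \<noteq> b" "parent ?S a \<noteq> Some b"
      "parent ?S b \<noteq> Some a" "x \<in> range_lam" "y \<in> range_lam"
    then show "slack ?S (a, b) x = slack ?S (a, b) y"
      unfolding slack using p'(3) by (intro frozenD[OF S'(5)]) (auto split: if_splits)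
  qed
  moreover have "valid l ?S"
    using S'(6) by (simp add: valid_def slack lab)
  moreover have "pointers l {} ?D ?S"
  proof (rule pointersI, goal_cases)
    case (1 u)
    then show ?case
      using pointersD(1-3)[OF S'(7), of u] i by auto
  next
    case (2 u v)
    then show ?case
      using pointersD(4)[OF S'(7), of u v] i w by (auto split: if_splits)
  next
    case (3 u v j)
    show ?case
    proof (cases "u = p")
      case True
      then have "j < i" "v = w"
        using 3 w by auto
      then have "adj p ! j \<noteq> adj p ! i"
        using distinct_adj[OF pV] i(1) by (simp add: nth_eq_iff_index_eq)
      with \<open>j < i\<close> \<open>v = w\<close> True i(3) w show ?thesis
        by simp
    next
      case False
      with 3 show ?thesis
        using pointersD(5)[OF S'(7), of u v j] by simp
    qed
  next
    case (4 u j)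
    then show ?case
      using pointersD(6)[OF S'(7), of u j] by (auto split: if_splits)
  qed
  ultimately show ?thesis
    by (simp add: inv_def)
qed

text \<open>Setting the ghost pointer to \<open>deg p\<close> records that the whole list is dead;
  this later forces the relabel to increase the label. From here on \<open>p\<close> is the excused
  vertex.\<close>

lemma inv_start_orphan:
  assumes S: "inv l {} D S" and p: "p \<in> orphans S"
    and all_dead: "\<And>j. j < deg p \<Longrightarrow> dead l S (adj p ! j)"
  shows "inv l {p} (D(p := deg p)) (S\<lparr>orphans := orphans S - {p}, ptr := (ptr S)(p := deg p)\<rparr>)"
    (is "inv l {p} ?D ?S")
proof -
  note S' = invD[OF S]
  have p': "p \<in> Vt S" "p \<noteq> t" "parent S p = None"
    using S'(3) p by (auto simp: orphans_except_def)
  have lab: "lab ?S = lab S" and slack: "slack ?S = slack S"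
    by (simp_all add: lab_def slack_def fun_eq_iff)
  have "pointers l {p} ?D ?S"
  proof (rule pointersI, goal_cases)
    case (1 u)
    then show ?case
      using pointersD(1-3)[OF S'(7), of u] by auto
  next
    case (2 u v)
    then show ?case
      using pointersD(4)[OF S'(7), of u v] p' by (auto split: if_splits)
  next
    case (3 u v j)
    then show ?case
      using pointersD(5)[OF S'(7), of u v j] p' by (auto split: if_splits)
  next
    case (4 u j)
    then show ?case
      using pointersD(6)[OF S'(7), of u j] all_dead by (auto split: if_splits)
  qed
  moreover have "frozen ?S"
    using S'(5) by (rule frozen_cong) (simp_all add: slack)
  moreover have "orphans_except {p} ?S"
    using S'(3) by (simp add: orphans_except_def)
  ultimately show ?thesis
    using S' by (simp add: inv_def shape_def tree_def limits_def valid_def lab slack)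
qed

lemma inv_relabel:
  assumes S: "inv l {p} D S" and p: "p \<in> Vt S" "p \<noteq> t" "parent S p = None"
    and childless: "\<And>v. parent S v \<noteq> Some p"
    and w: "w \<in> Vt S" "(p, w) \<in> E" "w \<noteq> p" "lab S p \<le> lab S w" "lab S w < n - 1"
    and closest: "\<And>v. v \<in> Vt S \<Longrightarrow> (p, v) \<in> E \<Longrightarrow> v \<noteq> p \<Longrightarrow> slack S (p, v) l > 0 \<Longrightarrow> lab S w \<le> lab S v"
  shows "inv l {} (D(p := 0)) (S\<lparr>label := (label S)(p := enat (lab S w + 1)),
           parent := (parent S)(p := Some w), ptr := (ptr S)(p := 0)\<rparr>)"
    (is "inv l {} _ ?S")
proof -
  note S' = invD[OF S]
  have lab: "lab ?S = (lab S)(p := lab S w + 1)"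
    by simp
  have slack: "slack ?S = slack S"
    by (simp add: slack_def fun_eq_iff)
  have dead: "dead l ?S (u, v)" if "dead l S (u, v)" "u \<noteq> p" for u v
    using that(1) by (rule dead_mono) (use that w(4) in \<open>simp_all add: slack lab\<close>)
  have dead_p: "dead l ?S (u, p)" if "u \<in> Vt S" "(u, p) \<in> E" "u \<noteq> p" for u
    using that validD[OF S'(6) that(1) p(1) that(2,3)] w(4) by (auto simp: dead_def slack lab)
  have "shape ?S"
    using S'(1) p w by (auto simp: shape_def)
  moreover have "tree ?S"
    using S'(2) childless p w by (auto simp: tree_def lab)
  moreover have "orphans_except {} ?S"
    using S'(3) by (auto simp: orphans_except_def)
  moreover have "limits ?S"
    using S'(4) p(3) by (rule limits_attach) (simp_all add: slack)
  moreover have "frozen ?S"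
  proof (rule frozenI)
    fix a b x y
    assume "a \<in> Vt ?S" "a \<noteq> t" "b \<in> Vt ?S" "(a, b) \<in> E" "a \<noteq> b" "parent ?S a \<noteq> Some b"
      "parent ?S b \<noteq> Some a" "x \<in> range_lam" "y \<in> range_lam"
    then show "slack ?S (a, b) x = slack ?S (a, b) y"
      unfolding slack using p(3) by (intro frozenD[OF S'(5)]) (auto split: if_splits)
  qed
  moreover have "valid l ?S"
    unfolding valid_def
  proof (intro ballI impI)
    fix a b assume ab: "a \<in> Vt ?S" "b \<in> Vt ?S" "(a, b) \<in> E" "a \<noteq> b" "slack ?S (a, b) l > 0"
    then show "lab ?S a \<le> lab ?S b + 1"
      using validD[OF S'(6), of a b] closest[of b] w(4) by (auto simp: slack lab)
  qed
  moreover have "pointers l {} (D(p := 0)) ?S"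
  proof (rule pointersI, goal_cases)
    case (1 u)
    then show ?case
      using pointersD(1-3)[OF S'(7), of u] by auto
  next
    case (2 u v)
    then show ?case
      using pointersD(4)[OF S'(7), of u v] by (auto split: if_splits)
  next
    case (3 u v j)
    then have u: "u \<noteq> p" "u \<in> Vt S" "adj u ! j \<noteq> (u, v)" "dead l S (adj u ! j)" "j < deg u"
      using pointersD(1,5)[OF S'(7), of u] by (auto split: if_splits dest: order_less_le_trans)
    moreover have "adj u ! j = (u, snd (adj u ! j))"
      using adj_nth(2)[OF shape_in_verts[OF S'(1) u(2)] u(5)] by (metis prod.collapse)
    ultimately show ?case
      using dead by metis
  next
    case (4 u j)
    then have u: "u \<noteq> p" "u \<in> Vt S" "dead l S (adj u ! j) \<or> snd (adj u ! j) = p" "j < deg u"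
      using pointersD(6)[OF S'(7), of u j] by (auto split: if_splits)
    moreover have "adj u ! j = (u, snd (adj u ! j))" "adj u ! j \<in> E"
      using adj_nth[OF shape_in_verts[OF S'(1) u(2)] u(4)] by (metis prod.collapse)+
    ultimately show ?case
      using dead dead_p by metis
  qed
  ultimately show ?thesis
    by (simp add: inv_def)
qed

lemma inv_contract:
  assumes S: "inv l {p} D S" and p: "p \<in> Vt S" "p \<noteq> t" "parent S p = None"
    and childless: "\<And>v. parent S v \<noteq> Some p"
  shows "inv l {} D (contract {p} (S\<lparr>beta := b, Vt := Vt S - {p}\<rparr>))" (is "inv l {} D ?S")
proof -
  note S' = invD[OF S]
  let ?S1 = "S\<lparr>beta := b, Vt := Vt S - {p}\<rparr>"
  have lab: "lab ?S = lab S"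
    by (simp add: lab_def fun_eq_iff)
  have edge: "(u, v) \<in> edges (net ?S)" "cap (net ?S) (u, v) = cap G (u, v)"
      "slack ?S (u, v) = slack S (u, v)"
    if "u \<in> Vt ?S" "v \<in> Vt ?S" "(u, v) \<in> E" for u v
  proof -
    have "(u, v) \<in> edges (net ?S1)" "u \<noteq> source (net ?S1)" "v \<noteq> source (net ?S1)" "u \<notin> {p}" "v \<notin> {p}"
      "cap (net ?S1) (u, v) = cap G (u, v)"
      using S'(1) that by (auto simp: shape_def)
    then show "(u, v) \<in> edges (net ?S)" "cap (net ?S) (u, v) = cap G (u, v)"
      "slack ?S (u, v) = slack S (u, v)"
      using contract_unaffected[of u v ?S1 "{p}"] by (simp_all add: slack_def fun_eq_iff)
  qed
  have dead: "dead l ?S (u, v)" if "dead l S (u, v) \<or> v = p" "u \<in> Vt ?S" "(u, v) \<in> E" for u v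
    using that edge(3)[of u v] by (auto simp: dead_def lab)
  have shape: "shape ?S"
    using S'(1) p(2) edge(1,2) by (auto simp: shape_def lab)
  moreover have tree: "tree ?S"
    using S'(2) p(3) childless by (auto simp: tree_def lab)
  moreover have "orphans_except {} ?S"
    using S'(3) by (auto simp: orphans_except_def)
  moreover have "limits ?S"
    unfolding limits_def
  proof (intro allI impI)
    fix a b assume "limit ?S (a, b) \<noteq> \<infinity>"
    then have *: "parent S a = Some b" "\<exists>x\<ge>lam_min G. limit S (a, b) = ereal x \<and> slack S (a, b) x = 0"
      using S'(4) by (auto simp: limits_def)
    then have "slack ?S (a, b) = slack S (a, b)"
      using treeD[OF tree, of a b] by (intro edge) simp_all
    with * show "parent ?S a = Some b \<and> (\<exists>x\<ge>lam_min G. limit ?S (a, b) = ereal x \<and> slack ?S (a, b) x = 0)"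
      by simp
  qed
  moreover have "frozen ?S"
  proof (rule frozenI)
    fix a b x y
    assume *: "a \<in> Vt ?S" "a \<noteq> t" "b \<in> Vt ?S" "(a, b) \<in> E" "a \<noteq> b" "parent ?S a \<noteq> Some b"
      "parent ?S b \<noteq> Some a" "x \<in> range_lam" "y \<in> range_lam"
    then show "slack ?S (a, b) x = slack ?S (a, b) y"
      unfolding edge(3)[OF *(1,3,4)] by (intro frozenD[OF S'(5)]) auto
  qed
  moreover have "valid l ?S"
    unfolding valid_def
  proof (intro ballI impI)
    fix a b assume ab: "a \<in> Vt ?S" "b \<in> Vt ?S" "(a, b) \<in> E" "a \<noteq> b" "slack ?S (a, b) l > 0"
    then show "lab ?S a \<le> lab ?S b + 1"
      using validD[OF S'(6), of a b] edge(3)[OF ab(1-3)] by (auto simp: lab)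
  qed
  moreover have "pointers l {} D ?S"
  proof (rule pointersI, goal_cases)
    case (1 u)
    then show ?case
      using pointersD(1-3)[OF S'(7), of u] by auto
  next
    case (2 u v)
    then show ?case
      using pointersD(4)[OF S'(7), of u v] by auto
  next
    case (3 u v j)
    then have u: "u \<in> Vt S" "adj u ! j \<noteq> (u, v)" "dead l S (adj u ! j)" "j < deg u"
      using pointersD(1,5)[OF S'(7), of u] by (auto dest: order_less_le_trans)
    moreover have "adj u ! j = (u, snd (adj u ! j))" "adj u ! j \<in> E"
      using adj_nth[OF shape_in_verts[OF S'(1) u(1)] u(4)] by (metis prod.collapse)+
    ultimately show ?case
      using dead 3(1) by metis
  next
    case (4 u j)
    then have u: "u \<in> Vt S" "dead l S (adj u ! j) \<or> snd (adj u ! j) = p" "j < deg u"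
      using pointersD(6)[OF S'(7), of u j] by auto
    moreover have "adj u ! j = (u, snd (adj u ! j))" "adj u ! j \<in> E"
      using adj_nth[OF shape_in_verts[OF S'(1) u(1)] u(3)] by (metis prod.collapse)+
    ultimately show ?case
      using dead 4(1) by metis
  qed
  ultimately show ?thesis
    by (simp add: inv_def)
qed

lemma remove_children_post:
  assumes S: "inv l {p} D S" and p: "p \<in> Vt S" "parent S p = None" and l: "l \<in> range_lam"
  shows "post (remove_children adj l p S) (\<lambda>S' k. (inv l {p} D S' \<and> Vt S' = Vt S \<and> label S' = label S \<and>
           parent S' p = None \<and> (\<forall>v. parent S' v \<noteq> Some p)) \<and> k \<le> deg p)"
proof -
  define I where "I ys S' \<longleftrightarrow> inv l {p} D S' \<and> Vt S' = Vt S \<and> label S' = label S \<and>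
      parent S' p = None \<and> (\<forall>v. (p, v) \<in> set ys \<longrightarrow> parent S' v \<noteq> Some p)" for ys :: "('v \<times> 'v) list" and S'
  note pV = shape_in_verts[OF invD(1)[OF S] p(1)]
  have "post (foreach (adj p) (\<lambda>x S. ret ((\<lambda>(_, v) S. if parent S v = Some p then remove_tree_edge l v p S else S) x S)) S)
      (\<lambda>S' k. I (adj p) S' \<and> k \<le> deg p)"
  proof (rule post_foreach_ret)
    show "I [] S"
      using S p by (simp add: I_def)
  next
    fix ys x zs S'
    assume xs: "adj p = ys @ x # zs" and I: "I ys S'"
    obtain v where x: "x = (p, v)" "v \<noteq> p"
      using adj_iff[OF pV, of x] xs by (cases x) auto
    show "I (ys @ [x]) ((case x of (_, v) \<Rightarrow> \<lambda>S. if parent S v = Some p then remove_tree_edge l v p S else S) S')"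
    proof (cases "parent S' v = Some p")
      case True
      with I x have "inv l {p} D (remove_tree_edge l v p S')"
        by (intro inv_remove_tree_edge[OF _ True l]) (auto simp: I_def)
      with I x True show ?thesis
        by (auto simp: I_def)
    qed (use I x in \<open>auto simp: I_def\<close>)
  qed
  then have "post (remove_children adj l p S) (\<lambda>S' k. I (adj p) S' \<and> k \<le> deg p)"
    by (simp add: remove_children_def case_prod_unfold)
  then show ?thesis
  proof (rule post_mono)
    fix S' k assume I: "I (adj p) S' \<and> k \<le> deg p"
    have "parent S' v \<noteq> Some p" for v
    proof
      \<comment> \<open>Every child is met by the loop: its tree edge is in \<open>E\<close>, and by
        symmetry the reverse edge is in the list of \<open>p\<close>.\<close>
      assume v: "parent S' v = Some p"
      then have "(v, p) \<in> E" "v \<noteq> p"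
        using I treeD[of S' v p] by (auto simp: I_def dest: invD)
      then have "(p, v) \<in> set (adj p)"
        using adj_iff[OF pV] edges_sym by auto
      with I v show False
        by (simp add: I_def)
    qed
    with I show "(inv l {p} D S' \<and> Vt S' = Vt S \<and> label S' = label S \<and>
           parent S' p = None \<and> (\<forall>v. parent S' v \<noteq> Some p)) \<and> k \<le> deg p"
      by (simp add: I_def)
  qed
qed

lemma closest_residual_post:
  assumes S: "shape S" and p: "p \<in> Vt S"
  shows "post (closest_residual adj l p S) (\<lambda>b k. (\<forall>w. b = Some w \<longrightarrow>
           w \<in> Vt S \<and> (p, w) \<in> E \<and> w \<noteq> p \<and> slack S (p, w) l > 0 \<and>
           (\<forall>v\<in>Vt S. (p, v) \<in> E \<longrightarrow> v \<noteq> p \<longrightarrow> slack S (p, v) l > 0 \<longrightarrow> lab S w \<le> lab S v)) \<and> k \<le> deg p)"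
proof -
  note pV = shape_in_verts[OF S p]
  let ?R = "\<lambda>ys. {v \<in> Vt S. (p, v) \<in> set ys \<and> residual l S (p, v)}"
  define I where "I ys b \<longleftrightarrow> (case b of None \<Rightarrow> ?R ys = {}
      | Some w \<Rightarrow> w \<in> ?R ys \<and> (\<forall>v\<in>?R ys. label S w \<le> label S v))" for ys b
  have "post (closest_residual adj l p S) (\<lambda>b k. I (adj p) b \<and> k \<le> (\<Sum>x\<leftarrow>adj p. 0 + 1))"
    unfolding closest_residual_def
  proof (rule post_foreach, goal_cases)
    case 1
    show ?case
      by (simp add: I_def)
  next
    case (2 ys x zs b)
    then have xs: "adj p = ys @ x # zs" and I: "I ys b"
      by auto
    obtain v where x: "x = (p, v)"
      using adj_iff[OF pV, of x] xs by (cases x) auto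
    show ?case
    proof (cases b)
      case None
      then show ?thesis
        using I x by (auto simp: I_def)
    next
      case (Some w)
      then show ?thesis
        using I x by (auto simp: I_def dest: order_less_imp_le order.trans)
    qed
  qed
  then show ?thesis
  proof (rule post_mono)
    fix b and k :: nat assume *: "I (adj p) b \<and> k \<le> (\<Sum>x\<leftarrow>adj p. 0 + 1)"
    have R: "v \<in> ?R (adj p) \<longleftrightarrow> v \<in> Vt S \<and> (p, v) \<in> E \<and> v \<noteq> p \<and> slack S (p, v) l > 0" for v
      using adj_iff[OF pV, of "(p, v)"] residual_iff_slack[OF S p, of v l] by auto
    have label: "label S u = enat (lab S u)" if "u \<in> Vt S" for u
      using S that by (simp add: shape_def)
    have "w \<in> Vt S \<and> (p, w) \<in> E \<and> w \<noteq> p \<and> slack S (p, w) l > 0 \<and>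
           (\<forall>v\<in>Vt S. (p, v) \<in> E \<longrightarrow> v \<noteq> p \<longrightarrow> slack S (p, v) l > 0 \<longrightarrow> lab S w \<le> lab S v)"
      if b: "b = Some w" for w
    proof -
      have w: "w \<in> ?R (adj p)" "\<And>v. v \<in> ?R (adj p) \<Longrightarrow> label S w \<le> label S v"
        using * b by (auto simp: I_def)
      then have "lab S w \<le> lab S v" if "v \<in> ?R (adj p)" for v
        using w(2)[OF that] label[of w] label[of v] w(1) that by simp
      with w(1) show ?thesis
        unfolding R by blast
    qed
    with * show "(\<forall>w. b = Some w \<longrightarrow> w \<in> Vt S \<and> (p, w) \<in> E \<and> w \<noteq> p \<and> slack S (p, w) l > 0 \<and>
           (\<forall>v\<in>Vt S. (p, v) \<in> E \<longrightarrow> v \<noteq> p \<longrightarrow> slack S (p, v) l > 0 \<longrightarrow> lab S w \<le> lab S v)) \<and> k \<le> deg p"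
      by (simp add: sum_list_triv)
  qed
qed

section \<open>The steps of the main loop\<close>

text \<open>An adoption at position \<open>i\<close> costs at most \<open>i - ptr S p + 1\<close>
  and raises the ghost pointer by \<open>Suc i - D p \<ge> 1\<close>. As \<open>D p\<close> may be
  one ahead of the pointer, the former tree edge may be tested again without progress;
  \<open>i - ptr S p + 2 \<le> 3 * (Suc i - D p)\<close> explains the factor 3. A relabel or
  contraction costs at most \<open>4 * deg p + 1\<close> and gains at least
  \<open>8 * (deg p + 1) - D p\<close>, which is ample.\<close>

lemma process_orphan_post:
  assumes S: "inv l {} D S" and p: "p \<in> orphans S" and l: "l \<in> range_lam"
  shows "post (process_orphan adj l p (S\<lparr>orphans := orphans S - {p}\<rparr>))
    (\<lambda>S' k. \<exists>D'. inv l {} D' S' \<and> 3 * potential D S + k + 1 \<le> 3 * potential D' S')"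
proof -
  note S' = invD[OF S]
  have p': "p \<in> Vt S" "p \<noteq> t" "parent S p = None"
    using S'(3) p by (auto simp: orphans_except_def)
  note pV = shape_in_verts[OF S'(1) p'(1)]
  have active: "p \<in> active"
    using S'(1) p' pV by (simp add: active_def shape_def)
  have lab_p: "lab S p < n" and label: "\<And>u. u \<in> Vt S \<Longrightarrow> label S u = enat (lab S u)"
    using S'(1) p'(1) by (simp_all add: shape_def)
  note ptr = pointersD(1-3)[OF S'(7) p'(1,2)]
  define c where "c = 8 * (deg p + 1)"
  have weight_p: "weight D S p = lab S p * c + D p"
    using p'(1) by (simp add: weight_def c_def)
  have c: "8 * deg p + 8 \<le> c"
    by (simp add: c_def)
  let ?S = "S\<lparr>orphans := orphans S - {p}\<rparr>"
  have admissible_iff: "admissible l ?S (adj p ! i) \<longleftrightarrow> snd (adj p ! i) \<in> Vt S \<and>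
      slack S (adj p ! i) l > 0 \<and> lab S p = lab S (snd (adj p ! i)) + 1" if i: "i < deg p" for i
  proof -
    obtain v where "adj p ! i = (p, v)" "(p, v) \<in> E"
      using adj_nth[OF pV i] by (cases "adj p ! i") auto
    then show ?thesis
      using residual_iff_slack[OF S'(1) p'(1), of v l] label[of v] label[OF p'(1)]
      by (auto simp: admissible_def residual_def one_enat_def)
  qed
  \<comment> \<open>Below \<open>D p\<close> deadness is remembered by the invariant; from
    \<open>D p\<close> on, which is not before the start of the scan, it follows from the failed
    test together with \<open>valid\<close>.\<close>
  have dead_if: "dead l S (adj p ! i)" if i: "i < deg p" "ptr S p \<le> i \<Longrightarrow> \<not> admissible l ?S (adj p ! i)" for i
  proof (cases "i < D p")
    case True
    then show ?thesis
      using pointersD(6)[OF S'(7) p'(1,2,3)] i(1) by simp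
  next
    case False
    obtain v where v: "adj p ! i = (p, v)" "(p, v) \<in> E" "v \<noteq> p"
      using adj_nth[OF pV i(1)] by (cases "adj p ! i") auto
    show ?thesis
      using i(2) admissible_iff[OF i(1)] False ptr(2) v validD[OF S'(6) p'(1) _ v(2)]
      by (force simp: dead_def)
  qed
  let ?goal = "\<lambda>S' k. \<exists>D'. inv l {} D' S' \<and> 3 * potential D S + k + 1 \<le> 3 * potential D' S'"
  \<comment> \<open>The remainder of \<open>process_orphan\<close>, for an arbitrary position
    \<open>i\<close> at which the scan stops and an arbitrary cost \<open>k\<close> of the
    scan.\<close>
  have "post (if i < deg p then ret (?S\<lparr>ptr := (ptr S)(p := i), parent := (parent S)(p := Some (snd (adj p ! i)))\<rparr>)
      else bind_comp (remove_children adj l p (?S\<lparr>ptr := (ptr S)(p := i)\<rparr>)) (\<lambda>S.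
        bind_comp (closest_residual adj l p S) (\<lambda>best.
        let relabel = (case best of None \<Rightarrow> False | Some w \<Rightarrow> label S w < enat (card (Vt S) - 1)) in
        if relabel then ret (S\<lparr>label := (label S)(p := label S (the best) + 1),
                parent := (parent S)(p := best), ptr := (ptr S)(p := 0)\<rparr>)
        else bind_comp (traverse (adj p)) (\<lambda>_.
          ret (contract {p} (S\<lparr>beta := (beta S)(p := ereal l), Vt := Vt S - {p}\<rparr>)))))) 
      (\<lambda>S' k'. ?goal S' (k + k'))"
    if i: "ptr S p \<le> i" "i \<le> deg p" and k: "k \<le> i - ptr S p + 1"
      and scanned: "\<And>j. ptr S p \<le> j \<Longrightarrow> j < i \<Longrightarrow> \<not> admissible l ?S (adj p ! j)"
      and found: "i < deg p \<Longrightarrow> admissible l ?S (adj p ! i)" for i k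
  proof (cases "i < deg p")
    case True
    note adm = found[OF True, unfolded admissible_iff[OF True]]
    let ?D = "D(p := Suc i)"
    let ?S1 = "?S\<lparr>ptr := (ptr S)(p := i), parent := (parent S)(p := Some (snd (adj p ! i)))\<rparr>"
    have dead: "dead l S (adj p ! j)" if "j < i" for j
      using that True scanned by (intro dead_if) auto
    have "inv l {} ?D ?S1"
      using inv_adopt[OF S p True i(1) dead] adm by simp
    moreover have "3 * potential D S + k + 1 \<le> 3 * potential ?D ?S1"
    proof -
      have "fst (adj p ! i) = p"
        using adj_nth[OF pV True] by simp
      then have "\<not> dead l S (adj p ! i)"
        using adm by (simp add: dead_def)
      \<comment> \<open>Positions below the ghost pointer of an orphan are dead, but the edge found
        is admissible, so it lies at or beyond \<open>D p\<close>.\<close>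
      then have "D p \<le> i"
        using pointersD(6)[OF S'(7) p'(1,2,3), of i] True by (metis empty_iff not_less)
      moreover have "potential ?D ?S1 + weight D S p = potential D S + weight ?D ?S1 p"
        by (rule potential_change[OF active]) (simp add: weight_def)
      moreover have "weight ?D ?S1 p = lab S p * c + Suc i"
        using p'(1) by (simp add: weight_def c_def)
      ultimately show ?thesis
        using weight_p k ptr i(1) by linarith
    qed
    ultimately show ?thesis
      using True by auto
  next
    case False
    then have i_eq: "i = deg p"
      using i by simp
    let ?D = "D(p := deg p)"
    let ?S1 = "?S\<lparr>ptr := (ptr S)(p := i)\<rparr>"
    have "dead l S (adj p ! j)" if "j < deg p" for j
      using that scanned i_eq by (intro dead_if) auto
    then have S1: "inv l {p} ?D ?S1"
      using inv_start_orphan[OF S p] i_eq by simp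
    have k: "k \<le> deg p + 1"
      using k i_eq by simp
    have "post (bind_comp (remove_children adj l p ?S1) (\<lambda>S.
        bind_comp (closest_residual adj l p S) (\<lambda>best.
        let relabel = (case best of None \<Rightarrow> False | Some w \<Rightarrow> label S w < enat (card (Vt S) - 1)) in
        if relabel then ret (S\<lparr>label := (label S)(p := label S (the best) + 1),
                parent := (parent S)(p := best), ptr := (ptr S)(p := 0)\<rparr>)
        else bind_comp (traverse (adj p)) (\<lambda>_.
          ret (contract {p} (S\<lparr>beta := (beta S)(p := ereal l), Vt := Vt S - {p}\<rparr>))))))
        (\<lambda>S' k'. ?goal S' (k + k'))"
    proof (intro post_bind, rule post_mono[OF remove_children_post[OF S1 _ _ l]], goal_cases)
      case (3 S2 k2)
      then have S2: "inv l {p} ?D S2" "Vt S2 = Vt S" "label S2 = label S" "parent S2 p = None"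
        "\<And>v. parent S2 v \<noteq> Some p" and k2: "k2 \<le> deg p"
        by auto
      note S2' = invD[OF S2(1)]
      have lab2: "lab S2 = lab S"
        by (simp add: lab_def fun_eq_iff S2(3))
      have p2: "p \<in> Vt S2"
        by (simp add: S2(2) p'(1))
      show ?case
      proof (intro post_bind, rule post_mono[OF closest_residual_post[OF S2'(1) p2, of l]], goal_cases)
        case (1 best k3)
        note best = this
        have k3: "k3 \<le> deg p"
          using best by blast
        show ?case
        proof (cases "\<exists>w. best = Some w \<and> label S2 w < enat (card (Vt S2) - 1)")
          case True
          then obtain w where w: "best = Some w" "label S2 w < enat (card (Vt S2) - 1)"
            by blast
          have w': "w \<in> Vt S2" "(p, w) \<in> E" "w \<noteq> p" "slack S2 (p, w) l > 0"
            "\<And>v. v \<in> Vt S2 \<Longrightarrow> (p, v) \<in> E \<Longrightarrow> v \<noteq> p \<Longrightarrow> slack S2 (p, v) l > 0 \<Longrightarrow> lab S2 w \<le> lab S2 v"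
            using best w(1) by blast+
          have label_w: "label S2 w = enat (lab S2 w)"
            using S2'(1) w'(1) by (simp add: shape_def)
          have "card (Vt S2) \<le> n"
            using S2'(1) finite_verts by (auto intro: card_mono simp: shape_def)
          then have "lab S2 w < n - 1"
            using w(2) label_w by simp
          \<comment> \<open>A residual edge in a list that is dead throughout cannot descend in
            label; hence the new label \<open>lab S2 w + 1\<close> exceeds the old one.\<close>
          moreover have "lab S2 p \<le> lab S2 w"
          proof -
            have "(p, w) \<in> set (adj p)"
              using adj_iff[OF pV] w' by simp
            then obtain j where j: "j < deg p" "adj p ! j = (p, w)"
              by (auto simp: in_set_conv_nth)
            then have "dead l S2 (p, w)"
              using pointersD(6)[OF S2'(7) p2 p'(2) S2(4), of j] w'(3) by simp
            with w' show ?thesis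
              by (simp add: dead_def)
          qed
          ultimately have "inv l {} (?D(p := 0)) (S2\<lparr>label := (label S2)(p := enat (lab S2 w + 1)),
              parent := (parent S2)(p := Some w), ptr := (ptr S2)(p := 0)\<rparr>)" (is "inv _ _ ?D3 ?S3")
            using w' by (intro inv_relabel[OF S2(1) p2 p'(2) S2(4,5)])
          moreover have "3 * potential D S + (k + (k2 + k3)) + 1 \<le> 3 * potential ?D3 ?S3"
          proof -
            have "potential ?D3 ?S3 + weight D S p = potential D S + weight ?D3 ?S3 p"
              by (rule potential_change[OF active]) (simp add: weight_def S2(2) lab2)
            moreover have "weight ?D3 ?S3 p = (lab S w + 1) * c"
              using p2 by (simp add: weight_def lab2 c_def)
            moreover have "lab S p * c + c \<le> (lab S w + 1) * c"
              using \<open>lab S2 p \<le> lab S2 w\<close> lab2 mult_le_mono1[of "lab S p + 1" "lab S w + 1" c] by simp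
            ultimately show ?thesis
              using weight_p c k k2 k3 ptr by linarith
          qed
          ultimately show ?thesis
            using w label_w by (auto simp: one_enat_def)
        next
          case False
          have "inv l {} ?D (contract {p} (S2\<lparr>beta := (beta S2)(p := ereal l), Vt := Vt S2 - {p}\<rparr>))"
            (is "inv _ _ _ ?S3")
            by (rule inv_contract[OF S2(1) p2 p'(2) S2(4,5)])
          moreover have "3 * potential D S + (k + (k2 + (k3 + k4))) + 1 \<le> 3 * potential ?D ?S3"
            if "k4 \<le> deg p" for k4
          proof -
            have "potential ?D ?S3 + weight D S p = potential D S + weight ?D ?S3 p"
              by (rule potential_change[OF active]) (simp add: weight_def S2(2) lab2)
            moreover have "weight ?D ?S3 p = n * c"
              by (simp add: weight_def c_def)
            moreover have "lab S p * c + c \<le> n * c"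
              using lab_p mult_le_mono1[of "lab S p + 1" n c] by simp
            ultimately show ?thesis
              using weight_p c k k2 k3 that ptr by linarith
          qed
          ultimately have "post (bind_comp (traverse (adj p)) (\<lambda>_. ret ?S3))
              (\<lambda>S' k'. ?goal S' (k + (k2 + (k3 + k'))))"
            by (intro post_bind post_mono[OF post_traverse]) auto
          with False show ?thesis
            by (auto simp: Let_def split: option.splits)
        qed
      qed
    qed (use p' in simp_all)
    with False show ?thesis
      by simp
  qed
  note main = this
  show ?thesis
    unfolding process_orphan_def
  proof (rule post_bind, rule post_mono[OF post_find_from], goal_cases)
    case (1 i k)
    then have "ptr S p \<le> i" "i \<le> deg p" "k \<le> i - ptr S p + 1"
      "\<And>j. ptr S p \<le> j \<Longrightarrow> j < i \<Longrightarrow> \<not> admissible l ?S (adj p ! j)"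
      "i < deg p \<Longrightarrow> admissible l ?S (adj p ! i)"
      using ptr(1) by auto
    from main[OF this] show ?case
      unfolding Let_def by (cases "i < deg p") simp_all
  qed
qed

lemma minimum_limit_post:
  assumes "limits S"
  shows "post (minimum_limit vs S) (\<lambda>b k. (b = \<infinity> \<or>
    (\<exists>u v. parent S u = Some v \<and> limit S (u, v) = b \<and> u \<in> verts G)) \<and> k \<le> n)"
proof -
  define I where "I ys b \<longleftrightarrow> b = \<infinity> \<or> (\<exists>u\<in>verts G. \<exists>v. parent S u = Some v \<and> limit S (u, v) = b)"
    for ys :: "'v list" and b
  have "post (minimum_limit vs S) (\<lambda>b k. I vs b \<and> k \<le> length vs)"
    unfolding minimum_limit_def
  proof (rule post_foreach_ret, goal_cases)
    case 1
    then show ?case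
      by (simp add: I_def)
  next
    case (2 ys u zs b)
    then have "u \<in> verts G"
      using vertex_list(2) by auto
    with 2 show ?case
      by (auto simp: I_def min_def split: option.splits)
  qed
  then show ?thesis
    using vertex_list(3) by (auto simp: I_def elim!: post_mono)
qed

text \<open>The witness \<open>u0\<close> attains the minimum limit. Other vertices lose only their
  own tree edge, so that of \<open>u0\<close> is still present with the same limit when its turn
  comes, and an orphan arises.\<close>

lemma remove_saturated_post:
  assumes S: "inv l {} D S" and l: "l \<in> range_lam"
    and u0: "parent S u0 = Some v0" "limit S (u0, v0) = ereal l" "u0 \<in> verts G"
  shows "post (remove_saturated vs l S) (\<lambda>S' k. (inv l {} D S' \<and> Vt S' = Vt S \<and> label S' = label S \<and>
    orphans S' \<noteq> {}) \<and> k \<le> n)"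
proof -
  define I where "I ys S' \<longleftrightarrow> inv l {} D S' \<and> Vt S' = Vt S \<and> label S' = label S \<and>
     (if u0 \<in> set ys then orphans S' \<noteq> {} else parent S' u0 = Some v0 \<and> limit S' (u0, v0) = ereal l)"
    for ys :: "'v list" and S'
  have "post (remove_saturated vs l S) (\<lambda>S' k. I vs S' \<and> k \<le> length vs)"
    unfolding remove_saturated_def
  proof (rule post_foreach_ret, goal_cases)
    case 1
    then show ?case
      using S u0 by (simp add: I_def)
  next
    case (2 ys u zs S1)
    then have u: "u \<notin> set ys" and I: "I ys S1"
      using vertex_list(1) by auto
    show ?case
    proof (cases "\<exists>v. parent S1 u = Some v \<and> limit S1 (u, v) = ereal l")
      case True
      then obtain v where v: "parent S1 u = Some v" "limit S1 (u, v) = ereal l"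
        by blast
      have "slack S1 (u, v) l = 0"
      proof -
        have "limits S1" "limit S1 (u, v) \<noteq> \<infinity>"
          using I v(2) invD(4)[of l "{}" D S1] by (simp_all add: I_def)
        then have "\<exists>x\<ge>lam_min G. limit S1 (u, v) = ereal x \<and> slack S1 (u, v) x = 0"
          unfolding limits_def by blast
        with v(2) show ?thesis
          by auto
      qed
      then have "inv l {} D (remove_tree_edge l u v S1)"
        using I by (intro inv_remove_tree_edge[OF _ v(1) l]) (auto simp: I_def)
      with I v u show ?thesis
        by (auto simp: I_def)
    next
      case False
      with I show ?thesis
        by (auto simp: I_def split: option.splits if_splits)
    qed
  qed
  then show ?thesis
    using vertex_list(2,3) u0(3) by (auto simp: I_def elim!: post_mono)
qed

text \<open>Filling the buckets, walking through the fewer than \<open>n\<close> buckets, and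
  draining their at most \<open>n\<close> entries cost at most \<open>n\<close> each.\<close>

lemma drain_post:
  assumes S: "inv l {} D S" "orphans S = {}" and l: "lam_min G \<le> l"
  shows "post (drain G vs l S) (\<lambda>S' k. (inv l {} D S' \<and> orphans S' = {} \<and> Vt S' = Vt S \<and>
    label S' = label S) \<and> k \<le> 3 * n)"
proof -
  define I where "I ys b \<longleftrightarrow> (\<forall>k. set (b k) \<subseteq> Vt S - {t}) \<and>
      (\<Sum>k=1..<n. length (b (enat k))) \<le> length ys"
    for ys :: "'v list" and b :: "enat \<Rightarrow> 'v list"
  let ?bucket = "foreach vs (\<lambda>v b. ret (if v \<in> Vt S \<and> v \<noteq> t then b(label S v := v # b (label S v)) else b))
      (\<lambda>_. [])"
  have buckets: "post ?bucket (\<lambda>b k. I vs b \<and> k \<le> length vs)"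
  proof (rule post_foreach_ret, goal_cases)
    case 1
    then show ?case
      by (simp add: I_def)
  next
    case (2 ys v zs b)
    have "(\<Sum>k=1..<n. length ((b(label S v := v # b (label S v))) (enat k))) \<le>
        (\<Sum>k=1..<n. length (b (enat k)) + of_bool (k = the_enat (label S v)))"
      by (rule sum_mono) (auto, metis the_enat.simps)
    also have "\<dots> \<le> (\<Sum>k=1..<n. length (b (enat k))) + 1"
      by (simp add: sum.distrib of_bool_def)
    finally show ?case
      using 2 by (auto simp: I_def split: if_splits)
  qed
  define J where "J S' \<longleftrightarrow> inv l {} D S' \<and> orphans S' = {} \<and> Vt S' = Vt S \<and> label S' = label S" for S'
  have drain_bucket: "post (foreach xs (drain_vertex l) S1) (\<lambda>S' k. J S' \<and> k \<le> (\<Sum>x\<leftarrow>xs. 0 + 1))"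
    if "J S1" "set xs \<subseteq> Vt S - {t}" for xs S1
  proof (rule post_foreach, goal_cases)
    case (2 ys u zs S2)
    then have "u \<in> Vt S - {t}"
      using that(2) by auto
    with 2 l show ?case
      by (intro post_mono[OF drain_vertex_inv]) (auto simp: J_def)
  qed (use that in simp)
  have "post (foreach (rev [1..<length vs]) (\<lambda>k. foreach (b (enat k)) (drain_vertex l)) S)
      (\<lambda>S' k. J S' \<and> k \<le> (\<Sum>k\<leftarrow>rev [1..<length vs]. length (b (enat k)) + 1))"
    if b: "I vs b" for b
  proof (rule post_foreach, goal_cases)
    case (2 ys k zs S1)
    with b show ?case
      using drain_bucket[of S1 "b (enat k)"] by (auto simp: I_def sum_list_triv elim!: post_mono)
  qed (use S in \<open>simp add: J_def\<close>)
  moreover have "(\<Sum>k\<leftarrow>rev [1..<length vs]. length (b (enat k)) + 1) \<le> 2 * n" if b: "I vs b" for b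
  proof -
    have "(\<Sum>k\<leftarrow>rev [1..<length vs]. length (b (enat k)) + 1) =
        (\<Sum>k=1..<n. length (b (enat k)) + 1)"
      by (simp add: rev_map[symmetric] interv_sum_list_conv_sum_set_nat vertex_list(3))
    also have "\<dots> = (\<Sum>k=1..<n. length (b (enat k))) + (n - 1)"
      by (subst sum.distrib) simp
    finally show ?thesis
      using b vertex_list(3) unfolding I_def by linarith
  qed
  ultimately have "post (foreach (rev [1..<length vs]) (\<lambda>k. foreach (b (enat k)) (drain_vertex l)) S)
      (\<lambda>S' k. J S' \<and> k \<le> 2 * n)" if "I vs b" for b
    using that by (blast intro: post_mono le_trans)
  note buckets_drained = this
  show ?thesis
    unfolding drain_def
  proof (rule post_bind, rule post_mono[OF buckets], goal_cases)
    case (1 b k)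
    then show ?case
      using vertex_list(3) by (intro post_mono[OF buckets_drained]) (auto simp: J_def)
  qed
qed

section \<open>The initial search\<close>

abbreviation "N\<^sub>0 \<equiv> network_at G (lam_min G)"

text \<open>The usual queue invariant: labels in the queue are sorted, and no label exceeds that of
  the head by more than one. \<open>Vt S - set q\<close> are the explored vertices, whose residual
  in-neighbours are all known. Bounding labels by \<open>card (Vt S)\<close> is inductive and gives
  labels below \<open>n\<close> at the end.\<close>

definition bfs :: "('v \<times> 'v \<Rightarrow> real) \<Rightarrow> 'v list \<Rightarrow> 'v pbfs \<Rightarrow> bool" where
  "bfs f q S \<longleftrightarrow>
     net S = G \<and> flow S = (\<lambda>e _. f e) \<and> ptr S = (\<lambda>_. 0) \<and> limit S = (\<lambda>_. \<infinity>) \<and> orphans S = {} \<and>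
     Vt S \<subseteq> verts G \<and> t \<in> Vt S \<and> distinct q \<and> set q \<subseteq> Vt S \<and> lab S t = 0 \<and> parent S t = None \<and>
     (\<forall>u\<in>Vt S. label S u = enat (lab S u) \<and> lab S u < card (Vt S)) \<and>
     (\<forall>u\<in>Vt S - {t}. parent S u \<noteq> None) \<and> tree S \<and>
     (\<forall>u v. parent S u = Some v \<longrightarrow> slack S (u, v) (lam_min G) > 0) \<and>
     sorted (map (lab S) q) \<and> (q \<noteq> [] \<longrightarrow> (\<forall>u\<in>Vt S. lab S u \<le> lab S (hd q) + 1)) \<and>
     (\<forall>v\<in>Vt S - set q. \<forall>u. (u, v) \<in> E \<longrightarrow> u \<noteq> v \<longrightarrow> slack S (u, v) (lam_min G) > 0 \<longrightarrow>
        u \<in> Vt S \<and> lab S u \<le> lab S v + 1)"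

lemma bfsD:
  assumes "bfs f q S"
  shows "net S = G" "flow S = (\<lambda>e _. f e)" "ptr S = (\<lambda>_. 0)" "limit S = (\<lambda>_. \<infinity>)" "orphans S = {}"
    "Vt S \<subseteq> verts G" "t \<in> Vt S" "distinct q" "set q \<subseteq> Vt S" "lab S t = 0" "parent S t = None"
    "\<And>u. u \<in> Vt S \<Longrightarrow> label S u = enat (lab S u)" "\<And>u. u \<in> Vt S \<Longrightarrow> lab S u < card (Vt S)"
    "\<And>u. u \<in> Vt S \<Longrightarrow> u \<noteq> t \<Longrightarrow> parent S u \<noteq> None" "tree S"
    "\<And>u v. parent S u = Some v \<Longrightarrow> slack S (u, v) (lam_min G) > 0"
    "sorted (map (lab S) q)" "\<And>u. q \<noteq> [] \<Longrightarrow> u \<in> Vt S \<Longrightarrow> lab S u \<le> lab S (hd q) + 1"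
    "\<And>u v. v \<in> Vt S \<Longrightarrow> v \<notin> set q \<Longrightarrow> (u, v) \<in> E \<Longrightarrow> u \<noteq> v \<Longrightarrow>
       slack S (u, v) (lam_min G) > 0 \<Longrightarrow> u \<in> Vt S \<and> lab S u \<le> lab S v + 1"
  using assms by (simp_all add: bfs_def)

lemma bfsI:
  assumes "net S = G" "flow S = (\<lambda>e _. f e)" "ptr S = (\<lambda>_. 0)" "limit S = (\<lambda>_. \<infinity>)" "orphans S = {}"
    "Vt S \<subseteq> verts G" "t \<in> Vt S" "distinct q" "set q \<subseteq> Vt S" "lab S t = 0" "parent S t = None"
    "\<And>u. u \<in> Vt S \<Longrightarrow> label S u = enat (lab S u) \<and> lab S u < card (Vt S)"
    "\<And>u. u \<in> Vt S \<Longrightarrow> u \<noteq> t \<Longrightarrow> parent S u \<noteq> None" "tree S"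
    "\<And>u v. parent S u = Some v \<Longrightarrow> slack S (u, v) (lam_min G) > 0"
    "sorted (map (lab S) q)" "\<And>u. q \<noteq> [] \<Longrightarrow> u \<in> Vt S \<Longrightarrow> lab S u \<le> lab S (hd q) + 1"
    "\<And>u v. v \<in> Vt S \<Longrightarrow> v \<notin> set q \<Longrightarrow> (u, v) \<in> E \<Longrightarrow> u \<noteq> v \<Longrightarrow>
       slack S (u, v) (lam_min G) > 0 \<Longrightarrow> u \<in> Vt S \<and> lab S u \<le> lab S v + 1"
  shows "bfs f q S"
  using assms unfolding bfs_def by blast

lemma bfs_discover:
  assumes S: "bfs f (v # q) S" and u: "u \<notin> Vt S" "(u, v) \<in> E" "slack S (u, v) (lam_min G) > 0"
  shows "bfs f (v # q @ [u]) (S\<lparr>Vt := insert u (Vt S), parent := (parent S)(u := Some v),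
           label := (label S)(u := label S v + 1)\<rparr>)" (is "bfs f ?q ?S")
proof -
  note B = bfsD[OF S]
  have fin: "finite (Vt S)"
    using B(6) finite_verts by (rule finite_subset)
  have v: "v \<in> Vt S" "label S v = enat (lab S v)"
    using B(9,12) by simp_all
  have uv: "u \<noteq> t" "u \<in> verts G" "u \<noteq> v"
    using edges_subset u v(1) B(7) by auto
  have hd: "\<And>w. w \<in> Vt S \<Longrightarrow> lab S w \<le> lab S v + 1"
    using B(18) by simp
  have label: "label S v + 1 = enat (lab S v + 1)"
    using v(2) by (simp add: one_enat_def)
  have q: "set (v # q) \<subseteq> Vt S"
    by (rule B(9))
  show ?thesis
    unfolding label
  proof (rule bfsI, goal_cases)
    case (12 w)
    then show ?case
      using B(12,13)[of w] B(13)[OF v(1)] fin u(1) by auto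
  next
    case (13 w)
    then show ?case
      using B(14)[of w] by auto
  next
    case 14
    have "parent S w \<noteq> Some u" for w
      using treeD(3)[OF B(15)] u(1) by blast
    then show ?case
      using B(15) u v uv unfolding tree_def by auto
  next
    case (15 w w')
    then show ?case
      using B(16)[of w w'] u(3) by (auto split: if_splits)
  next
    case 16
    have "map ((lab S)(u := lab S v + 1)) (v # q @ [u]) = map (lab S) (v # q) @ [lab S v + 1]"
      using q u(1) by auto
    moreover have "sorted (map (lab S) (v # q) @ [lab S v + 1])"
      unfolding sorted_append using B(17) q hd by auto
    ultimately show ?case
      by (simp only: unaffected_simps)
  next
    case (17 w)
    then show ?case
      using hd[of w] uv(3) by auto
  next
    case (18 w x)
    then have "x \<noteq> u" "w \<in> Vt S \<and> lab S w \<le> lab S x + 1"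
      using B(19)[of x w] by auto
    with u(1) show ?case
      by auto
  qed (use B(1-11) u uv in auto)
qed

text \<open>In the loop invariant \<open>v\<close> stays at the head of the queue, because the
  condition on explored vertices holds for it only after its whole list has been scanned. The
  equation for \<open>Vt S' - set q'\<close> lets the time be charged to explored vertices.\<close>

lemma visit_post:
  assumes S: "bfs f (v # q) S"
  shows "post (visit G adj v q S) (\<lambda>(q', S') k. (bfs f q' S' \<and>
    Vt S' - set q' = insert v (Vt S - set (v # q))) \<and> k \<le> deg v)"
proof -
  have vV: "v \<in> verts G"
    using S by (auto simp: bfs_def)
  define I where "I = (\<lambda>ys (q', S'). bfs f (v # q') S' \<and> Vt S' - set (v # q') = Vt S - set (v # q) \<and>
     (\<forall>u. (v, u) \<in> set ys \<longrightarrow> slack S' (u, v) (lam_min G) > 0 \<longrightarrow> u \<in> Vt S'))"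
  have "post (foreach (adj v) (\<lambda>x a. ret ((\<lambda>(_, u) (q, S).
        if u \<notin> Vt S \<and> residual (lam_min G) S (u, v)
            then (q @ [u],
                  S\<lparr>Vt := insert u (Vt S),
                    parent := (parent S)(u := Some v),
                    label := (label S)(u := label S v + 1)\<rparr>)
            else (q, S)) x a)) (q, S)) (\<lambda>a k. I (adj v) a \<and> k \<le> deg v)"
  proof (rule post_foreach_ret, goal_cases)
    case 1
    then show ?case
      using S by (simp add: I_def)
  next
    case (2 ys x zs a)
    obtain q' S' where a: "a = (q', S')"
      by (cases a)
    obtain u where x: "x = (v, u)" "(v, u) \<in> E"
      using adj_iff[OF vV, of x] 2(1) by (cases x) auto
    have I: "bfs f (v # q') S'" "Vt S' - set (v # q') = Vt S - set (v # q)"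
        "\<And>u. (v, u) \<in> set ys \<Longrightarrow> slack S' (u, v) (lam_min G) > 0 \<Longrightarrow> u \<in> Vt S'"
      using 2(2) by (auto simp: I_def a)
    have residual: "residual (lam_min G) S' (u, v) \<longleftrightarrow> slack S' (u, v) (lam_min G) > 0"
      using I(1) by (simp add: bfs_def residual_def slack_def)
    show ?case
    proof (cases "u \<notin> Vt S' \<and> slack S' (u, v) (lam_min G) > 0")
      case True
      then show ?thesis
        using bfs_discover[OF I(1), of u] edges_sym x I(2,3) by (auto simp: I_def a residual)
    next
      case False
      then show ?thesis
        using I x(1) by (auto simp: I_def a residual)
    qed
  qed
  then have "post (visit G adj v q S) (\<lambda>a k. I (adj v) a \<and> k \<le> deg v)"
    by (simp add: visit_def case_prod_unfold if_distrib)
  then show ?thesis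
  proof (rule post_mono)
    fix a and k :: nat assume *: "I (adj v) a \<and> k \<le> deg v"
    obtain q' S' where a: "a = (q', S')"
      by (cases a)
    have I: "bfs f (v # q') S'" "Vt S' - set (v # q') = Vt S - set (v # q)"
        "\<And>u. (v, u) \<in> set (adj v) \<Longrightarrow> slack S' (u, v) (lam_min G) > 0 \<Longrightarrow> u \<in> Vt S'"
      using * by (auto simp: I_def a)
    have hd: "\<And>w. w \<in> Vt S' \<Longrightarrow> lab S' w \<le> lab S' v + 1" and q': "v \<in> Vt S'" "v \<notin> set q'"
      using I(1) by (simp_all add: bfs_def)
    have explored: "w \<in> Vt S' \<and> lab S' w \<le> lab S' v + 1"
      if "(w, v) \<in> E" "w \<noteq> v" "slack S' (w, v) (lam_min G) > 0" for w
    proof -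
      have "(v, w) \<in> set (adj v)"
        using adj_iff[OF vV] edges_sym that(1,2) by simp
      with I(3) hd that(3) show ?thesis
        by blast
    qed
    have hd': "lab S' w \<le> lab S' (hd q') + 1" if "q' \<noteq> []" "w \<in> Vt S'" for w
    proof -
      have "lab S' v \<le> lab S' (hd q')"
        using I(1) that(1) by (cases q') (simp_all add: bfs_def)
      with hd[OF that(2)] show ?thesis
        by simp
    qed
    have "bfs f q' S'"
    proof (rule bfsI, goal_cases)
      case (18 w x)
      then show ?case
        using explored[of w] bfsD(19)[OF I(1), of x w] by (cases "x = v") auto
    qed (use bfsD[OF I(1)] hd' in simp_all)
    moreover have "Vt S' - set q' = insert v (Vt S - set (v # q))"
      using I(2) q' by auto
    ultimately show "(case a of (q', S') \<Rightarrow> \<lambda>k. (bfs f q' S' \<and>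
        Vt S' - set q' = insert v (Vt S - set (v # q))) \<and> k \<le> deg v) k"
      using * a by simp
  qed
qed

text \<open>Following parents, whose labels decrease, gives a residual walk to \<open>t\<close> from
  every discovered vertex; from \<open>s\<close> it would be augmenting.\<close>

lemma bfs_source_unreached:
  assumes f: "is_maximum_flow N\<^sub>0 f" and S: "bfs f q S"
  shows "s \<notin> Vt S"
proof
  have walk: "(u, t) \<in> (residual_edges N\<^sub>0 f)\<^sup>*" if "u \<in> Vt S" for u
    using that
  proof (induction "lab S u" arbitrary: u rule: less_induct)
    case less
    show ?case
    proof (cases "u = t")
      case False
      then obtain v where v: "parent S u = Some v"
        using bfsD(14)[OF S less.prems] by blast
      have "tree S" "slack S (u, v) (lam_min G) > 0"
        using bfsD(15,16)[OF S] v by blast+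
      note uv = treeD[OF this(1) v] and slack = this(2)
      then have "(u, v) \<in> residual_edges N\<^sub>0 f"
        using bfsD(2)[OF S] by (simp add: residual_edges_def network_at_def slack_def)
      moreover have "(v, t) \<in> (residual_edges N\<^sub>0 f)\<^sup>*"
        using uv by (intro less.hyps) simp_all
      ultimately show ?thesis
        by (rule converse_rtrancl_into_rtrancl)
    qed simp
  qed
  assume "s \<in> Vt S"
  then show False
    using walk maximum_flow_no_residual_walk[OF network_at_flow_network[OF lam_min_in_range] f]
    by (simp add: network_at_def)
qed

section \<open>Establishing the invariant after the search\<close>

text \<open>\<open>U\<close> contains the vertices already treated by the saturation loop. Validity
  of labels is stated for the initial flow \<open>f\<close>, with which the flow functions inside
  \<open>Vt\<close> with tail other than \<open>t\<close> agree at \<open>lam_min G\<close>.\<close>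

definition saturating :: "('v \<times> 'v \<Rightarrow> real) \<Rightarrow> 'v set \<Rightarrow> 'v pbfs \<Rightarrow> bool" where
  "saturating f U S \<longleftrightarrow> shape S \<and> tree S \<and> limit S = (\<lambda>_. \<infinity>) \<and> ptr S = (\<lambda>_. 0) \<and> orphans S = {} \<and>
     sink (net S) = t \<and> lam_min (net S) = lam_min G \<and>
     (\<forall>u\<in>Vt S - {t}. parent S u \<noteq> None) \<and>
     (\<forall>u\<in>Vt S. \<forall>v\<in>Vt S. (u, v) \<in> E \<longrightarrow> u \<noteq> v \<longrightarrow> cap G (u, v) (lam_min G) - f (u, v) > 0 \<longrightarrow>
        lab S u \<le> lab S v + 1) \<and>
     (\<forall>u\<in>Vt S - {t}. \<forall>v\<in>Vt S - {t}. (u, v) \<in> E \<longrightarrow> flow S (u, v) = (\<lambda>_. f (u, v))) \<and>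
     (\<forall>u\<in>Vt S - {t}. (u, t) \<in> E \<longrightarrow> flow S (u, t) (lam_min G) = f (u, t) \<and>
        (flow S (u, t) = cap G (u, t) \<or>
         flow S (u, t) = (\<lambda>_. f (u, t)) \<and> (u \<in> U \<longrightarrow> f (u, t) \<noteq> cap G (u, t) (lam_min G))))"

lemma saturating_contract:
  assumes f: "is_maximum_flow N\<^sub>0 f" and S: "bfs f [] S"
  shows "saturating f {} (contract (verts G - Vt S) (S\<lparr>beta := b\<rparr>))" (is "saturating f {} ?S")
proof -
  note s = bfs_source_unreached[OF f S]
  have net: "net S = G" and flow: "flow S = (\<lambda>e _. f e)"
    using bfsD[OF S] by simp_all
  have edge: "(u, v) \<in> edges (net ?S)" "cap (net ?S) (u, v) = cap G (u, v)"
      "flow ?S (u, v) = (\<lambda>_. f (u, v))"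
    if "u \<in> Vt S" "v \<in> Vt S" "(u, v) \<in> E" for u v
    using contract_unaffected[of u v "S\<lparr>beta := b\<rparr>" "verts G - Vt S"] that s by (auto simp: net flow)
  note B = bfsD[OF S]
  have "adj u \<noteq> []" if u: "u \<in> Vt S" "u \<noteq> t" for u
  proof -
    obtain v where "parent S u = Some v"
      using B(14)[OF u] by blast
    note uv = treeD[OF B(15) this]
    have "(u, v) \<in> set (adj u)"
      using adj_iff[of u] u(1) B(6) uv by auto
    then show ?thesis
      by auto
  qed
  moreover have "lab S u < n" if "u \<in> Vt S" for u
    using B(13)[OF that] card_mono[OF finite_verts B(6)] by simp
  moreover have "source (net ?S) = s"
    by (simp add: net)
  ultimately have "shape ?S"
    unfolding shape_def using B(6,7,10,12) edge s by auto
  moreover have "tree ?S"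
    using B(15) by (simp add: tree_def)
  moreover have "lab S u \<le> lab S v + 1"
    if "u \<in> Vt S" "v \<in> Vt S" "(u, v) \<in> E" "u \<noteq> v" "cap G (u, v) (lam_min G) - f (u, v) > 0" for u v
    using B(2) B(19)[of v u] that by (simp add: slack_def)
  moreover have "lam_min (net ?S) = lam_min G" "sink (net ?S) = t" "limit ?S = (\<lambda>_. \<infinity>)"
      "ptr ?S = (\<lambda>_. 0)" "orphans ?S = {}"
    using B(1-5) by simp_all
  ultimately show ?thesis
    using edge(3) B(7,14) unfolding saturating_def by simp
qed

lemma saturating_cong:
  assumes "saturating f U S" "net S' = net S" "Vt S' = Vt S" "parent S' = parent S" "label S' = label S"
    "limit S' = limit S" "ptr S' = ptr S" "orphans S' = orphans S"
    "\<And>u v. u \<in> Vt S \<Longrightarrow> u \<noteq> t \<Longrightarrow> v \<in> Vt S \<Longrightarrow> (u, v) \<in> E \<Longrightarrow> (u, v) \<noteq> (w, t) \<Longrightarrow>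
       flow S' (u, v) = flow S (u, v)"
    "w \<in> Vt S \<Longrightarrow> w \<noteq> t \<Longrightarrow> (w, t) \<in> E \<Longrightarrow> flow S' (w, t) (lam_min G) = f (w, t) \<and>
        (flow S' (w, t) = cap G (w, t) \<or>
         flow S' (w, t) = (\<lambda>_. f (w, t)) \<and> f (w, t) \<noteq> cap G (w, t) (lam_min G))"
  shows "saturating f (insert w U) S'"
proof -
  have "lab S' = lab S"
    by (simp add: lab_def fun_eq_iff assms(5))
  note same = assms(2-8) this
  have "shape S'" "tree S'"
    using assms(1) by (simp_all add: saturating_def shape_def tree_def same)
  moreover have "flow S' (u, v) = (\<lambda>_. f (u, v))" if "u \<in> Vt S - {t}" "v \<in> Vt S - {t}" "(u, v) \<in> E" for u v
    using assms(1) assms(9)[of u v] that by (simp add: saturating_def)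
  moreover have "flow S' (u, t) (lam_min G) = f (u, t) \<and> (flow S' (u, t) = cap G (u, t) \<or>
      flow S' (u, t) = (\<lambda>_. f (u, t)) \<and> (u \<in> insert w U \<longrightarrow> f (u, t) \<noteq> cap G (u, t) (lam_min G)))"
    if u: "u \<in> Vt S - {t}" "(u, t) \<in> E" for u
  proof (cases "u = w")
    case False
    have "t \<in> Vt S"
      using assms(1) by (simp add: saturating_def shape_def)
    then have "flow S' (u, t) = flow S (u, t)"
      using assms(9)[of u t] u False by simp
    then show ?thesis
      using assms(1) u False unfolding saturating_def by simp
  qed (use assms(10) u in blast)
  ultimately show ?thesis
    using assms(1) by (simp add: saturating_def same)
qed

text \<open>Saturating the source edge affects no flow inside \<open>Vt\<close>, as \<open>s\<close>
  is outside; only the edge from \<open>v\<close> to \<open>t\<close> needs attention.\<close>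

lemma saturating_step:
  assumes S: "saturating f U S" and v: "v \<in> Vt S"
  shows "saturating f (insert v U) (saturate_sink_edge v (saturate_source_edge v S))"
proof -
  define S1 where "S1 = saturate_source_edge v S"
  have s: "s \<notin> Vt S" "source (net S) = s" "sink (net S) = t" "lam_min (net S) = lam_min G"
    and t: "t \<in> Vt S"
    using S by (simp_all add: saturating_def shape_def)
  have S1: "net S1 = net S" "Vt S1 = Vt S" "parent S1 = parent S" "label S1 = label S"
      "limit S1 = limit S" "ptr S1 = ptr S" "orphans S1 = orphans S"
    by (simp_all add: S1_def saturate_source_edge_def Let_def)
  have flow1: "flow S1 (a, b) = flow S (a, b)" if "a \<in> Vt S" "b \<in> Vt S" for a b
  proof -
    have "a \<noteq> source (net S)" "b \<noteq> source (net S)"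
      using that s(1,2) by auto
    then show ?thesis
      by (simp add: S1_def saturate_source_edge_def Let_def)
  qed
  let ?S2 = "saturate_sink_edge v S1"
  have flow2: "flow ?S2 (a, b) = flow S (a, b)"
    if "a \<in> Vt S" "a \<noteq> t" "b \<in> Vt S" "(a, b) \<noteq> (v, t)" for a b
    using that flow1[of a b] s(3) by (auto simp: saturate_sink_edge_def Let_def S1(1))
  have "saturating f (insert v U) ?S2"
  proof (rule saturating_cong[OF S])
    assume vt: "v \<noteq> t" "(v, t) \<in> E"
    then have *: "(v, t) \<in> edges (net S)" "cap (net S) (v, t) = cap G (v, t)"
      "flow S (v, t) (lam_min G) = f (v, t)"
      "flow S (v, t) = cap G (v, t) \<or> flow S (v, t) = (\<lambda>_. f (v, t))"
      using S v t unfolding saturating_def shape_def by blast+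
    show "flow ?S2 (v, t) (lam_min G) = f (v, t) \<and>
        (flow ?S2 (v, t) = cap G (v, t) \<or>
         flow ?S2 (v, t) = (\<lambda>_. f (v, t)) \<and> f (v, t) \<noteq> cap G (v, t) (lam_min G))"
    proof (cases "f (v, t) = cap G (v, t) (lam_min G)")
      case True
      then have "flow ?S2 (v, t) = cap G (v, t)"
        using vt * flow1[OF v t] by (simp add: saturate_sink_edge_def Let_def S1(1) s)
      with True show ?thesis
        by simp
    next
      case False
      then have "flow ?S2 (v, t) = flow S (v, t)"
        using * flow1[OF v t] by (simp add: saturate_sink_edge_def Let_def S1(1) s)
      with False * show ?thesis
        by auto
    qed
  qed (use flow2 S1 in \<open>simp_all add: saturate_sink_edge_def Let_def\<close>)
  then show ?thesis
    by (simp add: S1_def)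
qed

lemma Vt_saturate [simp]: "Vt (saturate_sink_edge v (saturate_source_edge v S)) = Vt S"
  by (simp add: saturate_sink_edge_def saturate_source_edge_def Let_def)

text \<open>The critical case of \<open>frozen\<close> is a non-tree edge from \<open>u\<close> to
  \<open>t\<close>. If it were residual, \<open>u\<close> would have label at most 1; but its parent
  is not \<open>t\<close>, so it has label at least 1 and \<open>u\<close> at least 2. Hence the
  edge is saturated, its flow function equals its capacity function, and its slack is 0
  throughout.\<close>

lemma saturating_inv:
  assumes f: "is_maximum_flow N\<^sub>0 f" and S: "saturating f (Vt S) S"
  shows "inv (lam_min G) {} (\<lambda>_. 0) S"
proof -
  have S': "shape S" "tree S" "limit S = (\<lambda>_. \<infinity>)" "ptr S = (\<lambda>_. 0)" "orphans S = {}"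
    using S by (simp_all add: saturating_def)
  have attached: "\<And>u. u \<in> Vt S \<Longrightarrow> u \<noteq> t \<Longrightarrow> parent S u \<noteq> None"
    using S by (simp add: saturating_def)
  have labels: "\<And>u v. u \<in> Vt S \<Longrightarrow> v \<in> Vt S \<Longrightarrow> (u, v) \<in> E \<Longrightarrow> u \<noteq> v \<Longrightarrow>
      cap G (u, v) (lam_min G) - f (u, v) > 0 \<Longrightarrow> lab S u \<le> lab S v + 1"
    using S by (simp add: saturating_def)
  have inner: "\<And>u v. u \<in> Vt S \<Longrightarrow> v \<in> Vt S \<Longrightarrow> (u, v) \<in> E \<Longrightarrow> u \<noteq> t \<Longrightarrow> v \<noteq> t \<Longrightarrow>
      flow S (u, v) = (\<lambda>_. f (u, v))"
    using S by (simp add: saturating_def)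
  have outer: "\<And>u. u \<in> Vt S \<Longrightarrow> (u, t) \<in> E \<Longrightarrow> u \<noteq> t \<Longrightarrow> flow S (u, t) (lam_min G) = f (u, t)"
      "\<And>u. u \<in> Vt S \<Longrightarrow> (u, t) \<in> E \<Longrightarrow> u \<noteq> t \<Longrightarrow> flow S (u, t) = cap G (u, t) \<or>
        f (u, t) \<noteq> cap G (u, t) (lam_min G)"
    using S unfolding saturating_def by blast+
  have t: "t \<in> Vt S" "lab S t = 0" and s: "s \<notin> Vt S"
    using S'(1) by (simp_all add: shape_def)
  have "frozen S"
  proof (rule frozenI)
    fix u v x y
    assume uv: "u \<in> Vt S" "u \<noteq> t" "v \<in> Vt S" "(u, v) \<in> E" "u \<noteq> v"
      "parent S u \<noteq> Some v" "x \<in> range_lam" "y \<in> range_lam"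
    show "slack S (u, v) x = slack S (u, v) y"
    proof (cases "v = t")
      case False
      have "u \<noteq> s"
        using uv(1) s by blast
      then have "cap G (u, v) x = cap G (u, v) y"
        using uv False by (intro constant_cap)
      with False uv show ?thesis
        by (simp add: slack_def inner)
    next
      case True
      have "\<not> cap G (u, t) (lam_min G) - f (u, t) > 0"
      proof
        assume "cap G (u, t) (lam_min G) - f (u, t) > 0"
        then have "lab S u \<le> 1"
          using labels[of u t] uv t True by simp
        obtain w where w: "parent S u = Some w"
          using attached uv(1,2) by blast
        note uw = treeD[OF S'(2) w]
        have "w \<noteq> t"
          using w uv(6) True by blast
        then obtain w' where "parent S w = Some w'"
          using attached uw(3) by blast
        then have "lab S w = lab S w' + 1"
          using treeD(5)[OF S'(2)] by blast
        with uw(5) \<open>lab S u \<le> 1\<close> show False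
          by simp
      qed
      moreover have "f (u, t) \<le> cap G (u, t) (lam_min G)"
        using f uv(4) True by (auto simp: is_maximum_flow_def is_flow_def network_at_def)
      ultimately have "flow S (u, t) = cap G (u, t)"
        using outer(2)[of u] uv True by force
      with True show ?thesis
        by (simp add: slack_def)
    qed
  qed
  moreover have "valid (lam_min G) S"
    unfolding valid_def
  proof (intro ballI impI)
    fix u v assume uv: "u \<in> Vt S" "v \<in> Vt S" "(u, v) \<in> E" "u \<noteq> v" "slack S (u, v) (lam_min G) > 0"
    show "lab S u \<le> lab S v + 1"
    proof (cases "u = t")
      case False
      then have "flow S (u, v) (lam_min G) = f (u, v)"
        using inner[of u v] outer(1)[of u] uv by (cases "v = t") auto
      then show ?thesis
        using labels[OF uv(1-4)] uv(5) by (simp add: slack_def)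
    qed (simp add: t)
  qed
  moreover have "limits S"
    by (simp add: limits_def S'(3))
  moreover have "orphans_except {} S"
    using attached by (auto simp: orphans_except_def S'(5))
  moreover have "pointers (lam_min G) {} (\<lambda>_. 0) S"
    by (simp add: pointers_def S'(4))
  ultimately show ?thesis
    using S'(1,2) by (simp add: inv_def)
qed

section \<open>Total time\<close>

lemma traverse_adj_post:
  "post (foreach vs (\<lambda>v _. if P v then ret () else traverse (adj v)) a) (\<lambda>_ k. k \<le> n + card E)"
proof -
  have "post (foreach vs (\<lambda>v _. if P v then ret () else traverse (adj v)) a)
      (\<lambda>_ k. True \<and> k \<le> (\<Sum>v\<leftarrow>vs. deg v + 1))"
    by (rule post_foreach) (use post_traverse in auto)
  moreover have "(\<Sum>v\<leftarrow>vs. deg v + 1) = (\<Sum>v\<in>verts G. deg v) + n"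
    using vertex_list sum_list_distinct_conv_sum_set[of vs "\<lambda>v. deg v + 1"] by (simp add: sum.distrib sum_Suc)
  ultimately show ?thesis
    using sum_deg_le by (auto elim!: post_mono)
qed

lemma initialize_post:
  assumes T: "\<forall>(f, k)\<in>outcomes (A N\<^sub>0). k \<le> T"
  shows "post (initialize A G vs adj)
    (\<lambda>S k. (\<exists>f. is_maximum_flow N\<^sub>0 f \<and> bfs f [t] S) \<and> k \<le> T + 2 * n + card E)"
proof -
  have init: "post (A N\<^sub>0) (\<lambda>f k. is_maximum_flow N\<^sub>0 f \<and> k \<le> T)"
    using algorithm network_at_flow_network[OF lam_min_in_range] T
    by (fastforce simp: maximum_flow_algorithm_def post_def)
  have bfs: "bfs f [t] \<lparr>net = G, Vt = {t}, parent = (\<lambda>_. None), label = (\<lambda>_. \<infinity>)(t := 0),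
          beta = (\<lambda>_. \<infinity>), ptr = (\<lambda>_. 0), flow = (\<lambda>e _. f e), excess = (\<lambda>_ _. 0),
          modified = {}, limit = (\<lambda>_. \<infinity>), orphans = {}\<rparr>" for f
    by (rule bfsI) (simp_all add: sink_in_verts lab_def tree_def zero_enat_def)
  show ?thesis
    unfolding initialize_def
    apply (rule post_bind, rule post_mono[OF init])
    apply (rule post_bind, rule post_mono[OF post_traverse])
    apply (rule post_bind, rule post_mono[OF traverse_adj_post[of "\<lambda>_. False", simplified]])
    using bfs vertex_list(3) by auto
qed

text \<open>Three passes cost \<open>n\<close> each, the traversal for the contraction at most
  \<open>n + card E\<close>, and the drain \<open>3 * n\<close>.\<close>

lemma set_up_post:
  assumes f: "is_maximum_flow N\<^sub>0 f" and S: "bfs f [] S"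
  shows "post (set_up G vs adj S) (\<lambda>S' k. (inv (lam_min G) {} (\<lambda>_. 0) S' \<and> orphans S' = {}) \<and>
    k \<le> 7 * n + card E)"
proof -
  let ?l = "lam_min G"
  define I where "I S1 \<longleftrightarrow> (\<exists>b. S1 = S\<lparr>beta := b\<rparr>)" for S1
  have betas: "post (foreach vs (\<lambda>v S. ret (S\<lparr>beta := (beta S)(v := if v \<in> Vt S then \<infinity> else ereal ?l)\<rparr>)) S)
      (\<lambda>S1 k. I S1 \<and> k \<le> length vs)"
  proof (rule post_foreach_ret)
    show "I S"
      unfolding I_def by (rule exI[of _ "beta S"]) simp
  qed (auto simp: I_def)
  define sat where "sat ys S1 \<longleftrightarrow> Vt S1 = Vt S \<and> saturating f (set ys \<inter> Vt S) S1" for ys S1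
  have saturate: "post (foreach vs (\<lambda>v S. ret (if v \<in> Vt S then saturate_sink_edge v (saturate_source_edge v S) else S))
      (contract (verts G - Vt S) (S\<lparr>beta := b\<rparr>))) (\<lambda>S1 k. sat vs S1 \<and> k \<le> length vs)" for b
  proof (rule post_foreach_ret, goal_cases)
    case 1
    show ?case
      using saturating_contract[OF f S] by (simp add: sat_def)
  next
    case (2 ys v zs S1)
    then show ?case
      using saturating_step[of f "set ys \<inter> Vt S" S1 v] by (auto simp: sat_def)
  qed
  define J where "J S1 \<longleftrightarrow> inv ?l {} (\<lambda>_. 0) S1 \<and> orphans S1 = {}" for S1
  have sat_J: "J S1" if "sat vs S1" for S1
  proof -
    have "set vs \<inter> Vt S = Vt S"
      using vertex_list(2) bfsD(6)[OF S] by auto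
    with that have "saturating f (Vt S1) S1"
      by (simp add: sat_def)
    with saturating_inv[OF f this] show ?thesis
      by (simp add: J_def saturating_def)
  qed
  have set_limits: "post (foreach vs (\<lambda>u S. ret (case parent S u of None \<Rightarrow> S | Some v \<Rightarrow> set_limit ?l u v S)) S1)
      (\<lambda>S1 k. J S1 \<and> k \<le> length vs)" if "J S1" for S1
  proof (rule post_foreach_ret, goal_cases)
    case (2 ys u zs S2)
    then show ?case
      using inv_set_limit[of ?l "{}" "\<lambda>_. 0" S2 u _ ?l] by (auto simp: J_def split: option.splits)
  qed (rule that)
  show ?thesis
    unfolding set_up_def Let_def
    apply (rule post_bind, rule post_mono[OF betas])
    apply (clarsimp simp: I_def)
    apply (rule post_bind, rule post_mono[OF traverse_adj_post])
    apply (rule post_bind, rule post_mono[OF saturate])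
    apply (rule post_bind, rule post_mono[OF set_limits], erule conjE, erule sat_J)
    apply (rule post_mono[OF drain_post[of ?l "\<lambda>_. 0"]])
    using vertex_list(3) by (auto simp: J_def)
qed

text \<open>
  In the adoption phase, either some processed orphan has already paid for the overhead of the
  current iteration, up to \<open>4 * n\<close> for its remainder, or there is still an orphan to pay.
\<close>

fun config_inv :: "nat \<Rightarrow> 'v config \<Rightarrow> nat \<Rightarrow> bool" where
  "config_inv T Start k \<longleftrightarrow> k = 0"
| "config_inv T (Reverse_BFS q S) k \<longleftrightarrow> (\<exists>f. is_maximum_flow N\<^sub>0 f \<and> bfs f q S) \<and>
     k \<le> T + 2 * n + card E + 1 + (\<Sum>v\<in>Vt S - set q. deg v + 1)"
| "config_inv T (Main_Loop l S) k \<longleftrightarrow> l \<in> range_lam \<and>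
     (\<exists>D. inv l {} D S \<and> orphans S = {} \<and> k \<le> T + 10 * n + 3 * card E + 2 + 9 * n * potential D S)"
| "config_inv T (Adoption l S) k \<longleftrightarrow> l \<in> range_lam \<and>
     (\<exists>D. inv l {} D S \<and> (k + 4 * n \<le> T + 10 * n + 3 * card E + 2 + 9 * n * potential D S \<or>
        orphans S \<noteq> {} \<and> k \<le> T + 10 * n + 3 * card E + 2 + 9 * n * potential D S + 3 * n))"
| "config_inv T (Return b) k \<longleftrightarrow> k \<le> T + 14 * n + 3 * card E + 2 + 144 * (n\<^sup>2 * card E)"

lemma potential_cong:
  "Vt S' = Vt S \<Longrightarrow> label S' = label S \<Longrightarrow> potential D S' = potential D S"
  by (simp add: potential_def weight_def lab_def cong: if_cong)

lemma potential_time: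
  assumes "inv l X D S"
  shows "9 * n * potential D S \<le> 144 * (n\<^sup>2 * card E)"
  using mult_le_mono2[OF potential_le[OF assms], of "9 * n"] by (simp add: power2_eq_square mult.assoc)

lemma sum_deg_Suc_le: "V \<subseteq> verts G \<Longrightarrow> (\<Sum>v\<in>V. deg v + 1) \<le> card E + n"
proof -
  assume V: "V \<subseteq> verts G"
  have "(\<Sum>v\<in>V. deg v + 1) \<le> (\<Sum>v\<in>verts G. deg v + 1)"
    using V finite_verts by (intro sum_mono2) auto
  also have "\<dots> = (\<Sum>v\<in>verts G. deg v) + n"
    by (subst sum.distrib) simp
  finally show ?thesis
    using sum_deg_le by linarith
qed

lemma config_inv_le:
  assumes "config_inv T c k"
  shows "k \<le> T + 14 * n + 3 * card E + 2 + 144 * (n\<^sup>2 * card E)"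
  using assms
proof (cases c)
  case (Reverse_BFS q S)
  with assms have "Vt S - set q \<subseteq> verts G"
    by (auto dest: bfsD(6))
  with assms sum_deg_Suc_le[OF this] Reverse_BFS show ?thesis
    by auto
next
  case (Main_Loop l S)
  with assms obtain D where "inv l {} D S" "k \<le> T + 10 * n + 3 * card E + 2 + 9 * n * potential D S"
    by auto
  with potential_time[OF this(1)] show ?thesis
    by linarith
next
  case (Adoption l S)
  with assms obtain D where "inv l {} D S"
    "k + 4 * n \<le> T + 10 * n + 3 * card E + 2 + 9 * n * potential D S \<or>
     k \<le> T + 10 * n + 3 * card E + 2 + 9 * n * potential D S + 3 * n"
    by auto
  with potential_time[OF this(1)] show ?thesis
    by linarith
qed auto

text \<open>The constants before the potential term add up the initialization:
  \<open>T + 2 * n + card E + 1\<close> for \<open>Start\<close>, \<open>n + card E\<close> for the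
  search, and \<open>7 * n + card E + 1\<close> for the set-up. Each \<open>1\<close> is the unit
  charged for a step.\<close>

lemma step_post:
  assumes T: "\<forall>(f, k)\<in>outcomes (A N\<^sub>0). k \<le> T"
    and c: "config_inv T c k" and not_done: "\<And>b. c \<noteq> Return b"
  shows "post (step A G vs adj c) (\<lambda>c' j. config_inv T c' (k + j + 1))"
proof (cases c)
  case Start
  have "post (initialize A G vs adj) (\<lambda>S j. config_inv T (Reverse_BFS [t] S) (k + j + 1))"
    using c Start by (intro post_mono[OF initialize_post[OF T]]) auto
  with Start show ?thesis
    by (auto intro!: post_bind)
next
  case (Reverse_BFS q S)
  then obtain f where f: "is_maximum_flow N\<^sub>0 f" "bfs f q S"
    and k: "k \<le> T + 2 * n + card E + 1 + (\<Sum>v\<in>Vt S - set q. deg v + 1)"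
    using c by auto
  show ?thesis
  proof (cases q)
    case Nil
    have "k \<le> T + 2 * n + card E + 1 + (card E + n)"
      using k sum_deg_Suc_le[of "Vt S"] bfsD(6)[OF f(2)] Nil by simp
    then have "post (set_up G vs adj S) (\<lambda>S' j. config_inv T (Main_Loop (lam_min G) S') (k + j + 1))"
      using f Nil lam_min_in_range by (intro post_mono[OF set_up_post[of f]]) fastforce+
    with Reverse_BFS Nil show ?thesis
      by (auto intro!: post_bind)
  next
    case (Cons v q')
    have "post (visit G adj v q' S) (\<lambda>(q'', S') j. config_inv T (Reverse_BFS q'' S') (k + j + 1))"
    proof (rule post_mono[OF visit_post[of f]])
      show "bfs f (v # q') S"
        using f(2) Cons by simp
    next
      fix a and j :: nat
      assume *: "(case a of (q'', S') \<Rightarrow> \<lambda>k. (bfs f q'' S' \<and>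
        Vt S' - set q'' = insert v (Vt S - set (v # q'))) \<and> k \<le> deg v) j"
      obtain q'' S' where a: "a = (q'', S')"
        by (cases a)
      have "finite (Vt S - set q)"
        using bfsD(6)[OF f(2)] finite_verts by (meson finite_Diff finite_subset)
      moreover have "v \<notin> Vt S - set q"
        using Cons by simp
      moreover have "Vt S' - set q'' = insert v (Vt S - set q)"
        using * a Cons by simp
      ultimately have "(\<Sum>v\<in>Vt S' - set q''. deg v + 1) = deg v + 1 + (\<Sum>v\<in>Vt S - set q. deg v + 1)"
        by simp
      with * a k f(1) show "(case a of (q'', S') \<Rightarrow> \<lambda>j. config_inv T (Reverse_BFS q'' S') (k + j + 1)) j"
        by auto
    qed
    then show ?thesis
      unfolding Reverse_BFS Cons by (auto intro!: post_bind elim!: post_mono)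
  qed
next
  case (Main_Loop l S)
  then obtain D where l: "l \<in> range_lam" and S: "inv l {} D S" "orphans S = {}"
    and k: "k \<le> T + 10 * n + 3 * card E + 2 + 9 * n * potential D S"
    using c by auto
  have return: "config_inv T (Return (beta S)) (k + j + 1)" if "j \<le> n" for j
    using k that potential_time[OF S(1)] n_ge_2 unfolding config_inv.simps by linarith
  have "post (if b > ereal (lam_max G) then ret (Return (beta S))
      else bind_comp (remove_saturated vs (real_of_ereal b) S) (\<lambda>S. ret (Adoption (real_of_ereal b) S)))
      (\<lambda>c' j. config_inv T c' (k + (i + j) + 1))"
    if b: "b = \<infinity> \<or> (\<exists>u v. parent S u = Some v \<and> limit S (u, v) = b \<and> u \<in> verts G)" and i: "i \<le> n" for b i
  proof (cases "b > ereal (lam_max G)")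
    case True
    with return i show ?thesis
      by simp
  next
    case False
    then have "b \<noteq> \<infinity>"
      by auto
    then obtain u v where uv: "parent S u = Some v" "limit S (u, v) = b" "u \<in> verts G" "b \<noteq> \<infinity>"
      using b by blast
    then obtain x where x: "x \<ge> lam_min G" "b = ereal x"
      using invD(4)[OF S(1)] unfolding limits_def by metis
    then have range: "x \<in> range_lam"
      using False by simp
    have "post (remove_saturated vs x S) (\<lambda>S' j. config_inv T (Adoption x S') (k + (i + j) + 1))"
    proof (rule post_mono[OF remove_saturated_post[of x D S u v]])
      show "inv x {} D S"
        by (rule inv_change_lambda[OF S l range])
      fix S' and j :: nat
      assume *: "(inv x {} D S' \<and> Vt S' = Vt S \<and> label S' = label S \<and> orphans S' \<noteq> {}) \<and> j \<le> n"
      then have "potential D S' = potential D S"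
        by (intro potential_cong) simp_all
      with * k i range n_ge_2 show "config_inv T (Adoption x S') (k + (i + j) + 1)"
        by auto
    qed (use uv x range in auto)
    with False x show ?thesis
      by (auto intro!: post_bind elim!: post_mono simp del: config_inv.simps)
  qed
  then have "post (bind_comp (minimum_limit vs S) (\<lambda>b. if b > ereal (lam_max G) then ret (Return (beta S))
      else bind_comp (remove_saturated vs (real_of_ereal b) S) (\<lambda>S. ret (Adoption (real_of_ereal b) S))))
      (\<lambda>c' j. config_inv T c' (k + j + 1))"
    by (intro post_bind post_mono[OF minimum_limit_post[OF invD(4)[OF S(1)]]]) blast
  with return[of 0] show ?thesis
    unfolding Main_Loop by simp
next
  case (Adoption l S)
  let ?B = "T + 10 * n + 3 * card E + 2"
  obtain D where l: "l \<in> range_lam" and S: "inv l {} D S"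
    and k: "k + 4 * n \<le> ?B + 9 * n * potential D S \<or>
        orphans S \<noteq> {} \<and> k \<le> ?B + 9 * n * potential D S + 3 * n"
    using c Adoption by auto
  show ?thesis
  proof (cases "orphans S = {}")
    case True
    have "post (drain G vs l S) (\<lambda>S' j. config_inv T (Main_Loop l S') (k + j + 1))"
    proof (rule post_mono[OF drain_post[OF S True]])
      fix S' and j :: nat
      assume *: "(inv l {} D S' \<and> orphans S' = {} \<and> Vt S' = Vt S \<and> label S' = label S) \<and> j \<le> 3 * n"
      then have "potential D S' = potential D S"
        by (intro potential_cong) simp_all
      with * k True l n_ge_2 show "config_inv T (Main_Loop l S') (k + j + 1)"
        by auto
    qed (use l in simp)
    with Adoption True show ?thesis
      by (auto intro!: post_bind)
  next
    case False
    have "post (process_orphan adj l u (S\<lparr>orphans := orphans S - {u}\<rparr>))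
        (\<lambda>S' j. config_inv T (Adoption l S') (k + j + 1))" if u: "u \<in> orphans S" for u
    proof (rule post_mono[OF process_orphan_post[OF S u l]])
      fix S' and j :: nat
      assume "\<exists>D'. inv l {} D' S' \<and> 3 * potential D S + j + 1 \<le> 3 * potential D' S'"
      then obtain D' where D': "inv l {} D' S'" "3 * potential D S + j + 1 \<le> 3 * potential D' S'"
        by blast
      then obtain d where d: "potential D' S' = potential D S + d" "1 \<le> d" "j + 1 \<le> 3 * d"
        by (intro that[of "potential D' S' - potential D S"]) auto
      \<comment> \<open>\<open>7 * n\<close> consists of the \<open>3 * n\<close> already spent in
        this iteration and the \<open>4 * n\<close> reserved for the drain; \<open>3 * d\<close>
        pays for processing the orphan. Both \<open>d \<ge> 1\<close> and \<open>n \<ge> 2\<close>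
        enter.\<close>
      have "7 * n + 3 * d \<le> 9 * n * d"
      proof -
        have "7 * n \<le> 7 * n * d" "3 * d \<le> 2 * n * d"
          using d(2) n_ge_2 by auto
        then show ?thesis
          by linarith
      qed
      moreover have "9 * n * potential D' S' = 9 * n * potential D S + 9 * n * d"
        unfolding d(1) by (simp add: distrib_left)
      ultimately have "k + j + 1 + 4 * n \<le> ?B + 9 * n * potential D' S'"
        using k d(3) by linarith
      with D'(1) l show "config_inv T (Adoption l S') (k + j + 1)"
        by auto
    qed
    with Adoption False show ?thesis
      by (auto intro!: post_bind)
  qed
qed (use not_done in simp)

lemma pbfs_time:
  assumes T: "\<forall>(f, k)\<in>outcomes (A N\<^sub>0). k \<le> T"
  shows "pbfs_runs_in_time A G vs adj (T + 14 * n + 3 * card E + 2 + 144 * (n\<^sup>2 * card E))"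
proof -
  have "config_inv T c k" if "run A G vs adj c k" for c k
    using that
  proof (induction rule: run.induct)
    case (step c k c' j)
    have "\<And>b. c \<noteq> Return b"
      using step.hyps(2) by auto
    from step_post[OF T step.IH this] step.hyps(2) show ?case
      by (auto simp: post_def)
  qed simp
  then show ?thesis
    using config_inv_le step_post[OF T] unfolding pbfs_runs_in_time_def post_def by metis
qed

end

theorem theorem28:
  fixes A :: "('v, real) network \<Rightarrow> ('v \<times> 'v \<Rightarrow> real) comp"
  assumes "maximum_flow_algorithm A"
    and "\<exists>K. \<forall>N. flow_network N \<and> edges N \<noteq> {} \<longrightarrow>
           (\<forall>(f, k)\<in>outcomes (A N). k \<le> K * ((card (verts N))\<^sup>2 * card (edges N)))"
  shows "\<exists>C. \<forall>(G :: 'v parametric_network) vs adj.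
           parametric_flow_network G \<and> source_sink_monotone G \<and> edges G \<noteq> {} \<and>
           represents vs adj G \<longrightarrow>
           pbfs_runs_in_time A G vs adj (C * ((card (verts G))\<^sup>2 * card (edges G)))"
proof -
  obtain K where K: "\<And>N f k. flow_network N \<Longrightarrow> edges N \<noteq> {} \<Longrightarrow> (f, k) \<in> outcomes (A N) \<Longrightarrow>
      k \<le> K * ((card (verts N))\<^sup>2 * card (edges N))"
    using assms(2) by fast
  \<comment> \<open>\<open>163 = 14 + 3 + 2 + 144\<close>: as there are vertices and edges, each of
    \<open>n\<close>, \<open>card E\<close> and 1 is at most
    \<open>n\<^sup>2 * card E\<close>.\<close>
  have "pbfs_runs_in_time A G vs adj ((K + 163) * ((card (verts G))\<^sup>2 * card (edges G)))"
    if G: "parametric_flow_network G" "source_sink_monotone G" "edges G \<noteq> {}" "represents vs adj G"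
    for G :: "'v parametric_network" and vs adj
  proof -
    interpret pbfs_input A G vs adj
      using assms(1) G by unfold_locales
    let ?n = "card (verts G)" and ?m = "card (edges G)"
    let ?T = "K * (?n\<^sup>2 * ?m)"
    have time: "pbfs_runs_in_time A G vs adj (?T + 14 * ?n + 3 * ?m + 2 + 144 * (?n\<^sup>2 * ?m))"
      using K[OF network_at_flow_network[OF lam_min_in_range]] G(3)
      by (intro pbfs_time) (auto simp: network_at_def)
    have n: "1 \<le> ?n"
      using n_ge_2 by linarith
    have m: "1 \<le> ?m"
      using G(3) finite_edges by (simp add: Suc_le_eq card_gt_0_iff)
    have "?n * 1 \<le> ?n * (?n * ?m)" "1 * ?m \<le> ?n\<^sup>2 * ?m"
      using n m by (intro mult_le_mono; simp add: Suc_le_eq)+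
    then have "?n \<le> ?n\<^sup>2 * ?m" "?m \<le> ?n\<^sup>2 * ?m"
      by (simp_all add: power2_eq_square mult.assoc)
    then have "?T + 14 * ?n + 3 * ?m + 2 + 144 * (?n\<^sup>2 * ?m) \<le> (K + 163) * (?n\<^sup>2 * ?m)"
      using m by (simp only: distrib_right)
    with time show ?thesis
      unfolding pbfs_runs_in_time_def by (meson le_trans)
  qed
  then show ?thesis
    by blast
qed

end
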